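(* Let $n\ge2$ and $\sigma,\tau>0$ be such that $w_n<\tau$. Let $g^{(0)}\in\mathcal F$ and define $g^{(t+1)}=\mathcal Tg^{(t)}$ for $t\ge0$. Then the sequence $\{g^{(t)}\}$ converges, in $\mathcal L_\infty$ norm, to a unique fixed point $g=\mathcal Tg$ in the space $\mathcal F$ (that is, $\mathcal T$ has exactly one fixed point in $\mathcal F$, and $g^{(t)}$ converges uniformly to it). Here $w_n$, $\mathcal F$ and $\mathcal T$ are as defined in the context.
   Context: Underlying model. Let $\theta$ be uniformly distributed over $\mathbb{R}$ (improper flat prior), $x_i=\theta+\xi_i$ for $i\in[n]=\{1,\dots,n\}$ and $y_{ji}=x_j+\zeta_{ji}$ for $j\ne i$, where the $\xi_i$ are i.i.d. $\mathcal N(0,\sigma^2)$ and the $\zeta_{ji}$ are i.i.d. $\mathcal N(0,\tau^2)$, all independent. Let $y_i=(x_i,\{y_{ji}\}_{j\in[n]\setminus\{i\}})\in\mathbb{R}^n$. Families indexed by $[n]$ are listed in increasing order of the index. Conditional laws given $y_i$ are formal posteriors: one takes the $\sigma$-finite measure under which $\theta$ has Lebesgue measure and the noises have the stated laws, and conditions by normalizing the joint density (this gives proper Gaussian laws). Constants. For $m\ge1$: $\frac1{\eta_m^2}=\frac1{\sigma^2}+\frac{m-1}{\sigma^2+\tau^2}$, $a_m=\eta_m^2/\sigma^2$, $b_m=\eta_m^2/(\sigma^2+\tau^2)$. For $n\ge2$: $\frac1{\gamma_n^2}=\frac1{\tau^2}+\frac1{\eta_{n-1}^2+\sigma^2}$,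 $c_n=\gamma_n^2/(\eta_{n-1}^2+\sigma^2)$, $d_n=\gamma_n^2/\tau^2$, $e_n=\max\{c_na_{n-1},d_n,c_nb_{n-1}\}$, and $$w_n=\max\Big\{\tfrac{(n-1)(e_n(na_n+(n-2)b_n)+b_n)}{b_n^2},\ \tfrac{(n-1)\left(e_n(na_n+(n-2)b_n)(b_n+2a_n)+b_n^2\right)}{a_nb_n^2}\Big\}.$$ Operator $\mathcal T$. Fix distinct $i,k\in[n]$ and write points of $\mathbb{R}^{n-1}$ as $y=y_{i\setminus k}=(x_i,\{y_{ji}\}_{j\in[n]\setminus\{i,k\}})$. Given $g:\mathbb{R}^{n-1}\to\mathbb{R}$ (continuous) and $y$, set $y_{ki}=\frac1{b_n}g(y)-\frac{a_n}{b_n}x_i-\sum_{j\in[n]\setminus\{k,i\}}y_{ji}$, and for $l\in[n]\setminus\{i\}$ and $j\in[n]\setminus\{i,l\}$ put $\overline{x_l}=c_na_{n-1}x_i+d_ny_{li}+c_nb_{n-1}\sum_{m\in[n]\setminus\{i,l\}}y_{mi}$ and $\overline{y_{jl}}=c_na_{n-1}x_i+d_ny_{ji}+c_nb_{n-1}\sum_{m\in[n]\setminus\{i,j\}}y_{mi}$. For $\epsilon=(\epsilon_l,\{\epsilon_{jl}\}_{j\in[n]\setminus\{i,l\}})\in\mathbb{R}^{n-1}$ let $$\mathcal M_{\epsilon,l}g(y)=\frac1{b_n\tau}\Big(g(\overline{x_l}+\epsilon_l,\{\overline{y_{jl}}+\epsilon_{jl}\}_{j\in[n]\setminus\{i,l\}})-a_n(\overline{x_l}+\epsilon_l)-b_n\sum_{j\in[n]\setminus\{i,l\}}(\overline{y_{jl}}+\epsilon_{jl})-b_nx_i\Big),$$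 $$\mathcal Tg(y)=1+\sum_{l\in[n]\setminus\{i\}}\int_{\mathbb{R}^{n-1}}\varphi(\mathcal M_{\epsilon,l}g(y))f_\epsilon(\epsilon)\,d\epsilon,$$ where $\varphi$ is the standard normal CDF and $f_\epsilon$ is the density of the centered Gaussian vector whose covariance is the conditional covariance of $(x_l,\{y_{jl}\}_{j\in[n]\setminus\{i,l\}})$ given $y_i$. For $g:\mathbb{R}^{n-1}\to\mathbb{R}$ define $h_g:\mathbb{R}^n\to\mathbb{R}$ by $h_g(x_i,\{y_{ji}\}_{j\ne i})=\frac1{b_n}g(y_{i\setminus k})-\frac{a_n}{b_n}x_i-\sum_{j\in[n]\setminus\{i\}}y_{ji}$. The function $g$ is quasi-symmetric if the zero set of $h_g$ is invariant under permutations of the coordinates $\{y_{ji}\}_{j\ne i}$. $\mathcal F$ is the set of quasi-symmetric $g:\mathbb{R}^{n-1}\to\mathbb{R}$ that are Lipschitz with constant $a_n$ with respect to the $\ell_1$ norm on $\mathbb{R}^{n-1}$. The $\mathcal L_\infty$ norm is the supremum norm over $\mathbb{R}^{n-1}$. *)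

theory Defs
  imports "HOL-Probability.Probability"
begin

section \<open>Constants\<close>

text \<open>Only the squares of the constants \<open>\<eta>\<^sub>m\<close>, \<open>\<gamma>\<^sub>n\<close> of the model are ever used.\<close>

definition eta_sq :: "real \<Rightarrow> real \<Rightarrow> nat \<Rightarrow> real" where
  "eta_sq \<sigma> \<tau> m = 1 / (1 / \<sigma>\<^sup>2 + (real m - 1) / (\<sigma>\<^sup>2 + \<tau>\<^sup>2))"

definition coef_a :: "real \<Rightarrow> real \<Rightarrow> nat \<Rightarrow> real" where
  "coef_a \<sigma> \<tau> m = eta_sq \<sigma> \<tau> m / \<sigma>\<^sup>2"

definition coef_b :: "real \<Rightarrow> real \<Rightarrow> nat \<Rightarrow> real" where
  "coef_b \<sigma> \<tau> m = eta_sq \<sigma> \<tau> m / (\<sigma>\<^sup>2 + \<tau>\<^sup>2)"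

definition gamma_sq :: "real \<Rightarrow> real \<Rightarrow> nat \<Rightarrow> real" where
  "gamma_sq \<sigma> \<tau> n = 1 / (1 / \<tau>\<^sup>2 + 1 / (eta_sq \<sigma> \<tau> (n - 1) + \<sigma>\<^sup>2))"

definition coef_c :: "real \<Rightarrow> real \<Rightarrow> nat \<Rightarrow> real" where
  "coef_c \<sigma> \<tau> n = gamma_sq \<sigma> \<tau> n / (eta_sq \<sigma> \<tau> (n - 1) + \<sigma>\<^sup>2)"

definition coef_d :: "real \<Rightarrow> real \<Rightarrow> nat \<Rightarrow> real" where
  "coef_d \<sigma> \<tau> n = gamma_sq \<sigma> \<tau> n / \<tau>\<^sup>2"

definition coef_e :: "real \<Rightarrow> real \<Rightarrow> nat \<Rightarrow> real" where
  "coef_e \<sigma> \<tau> n =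
     Max {coef_c \<sigma> \<tau> n * coef_a \<sigma> \<tau> (n - 1), coef_d \<sigma> \<tau> n, coef_c \<sigma> \<tau> n * coef_b \<sigma> \<tau> (n - 1)}"

definition coef_w :: "real \<Rightarrow> real \<Rightarrow> nat \<Rightarrow> real" where
  "coef_w \<sigma> \<tau> n =
     (let a = coef_a \<sigma> \<tau> n; b = coef_b \<sigma> \<tau> n; e = coef_e \<sigma> \<tau> n;
          s = real n * a + (real n - 2) * b
      in max ((real n - 1) * (e * s + b) / b\<^sup>2)
             ((real n - 1) * (e * s * (b + 2 * a) + b\<^sup>2) / (a * b\<^sup>2)))"


section \<open>Indexing of observations\<close>

text \<open>
  Agents are \<open>{1..n}\<close>.  An observation \<open>y\<^sub>l = (x\<^sub>l, {y\<^sub>j\<^sub>l}\<^bsub>j \<noteq> l\<^esub>)\<close> is encoded as a family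
  \<open>v\<close> of reals over \<open>{1..n}\<close>, where \<open>v l = x\<^sub>l\<close> and \<open>v j = y\<^sub>j\<^sub>l\<close> for \<open>j \<noteq> l\<close>.

  The space of \<open>(n - 1)\<close>-tuples is \<open>real ^ 'm\<close> with \<open>CARD('m) + 1 = n\<close>; the linear order on
  \<open>'m\<close> orders the positions of a tuple.  \<open>slot n l k r\<close> is the agent whose signal is at position
  \<open>r\<close> of the tuple \<open>(x\<^sub>l, {y\<^sub>j\<^sub>l}\<^bsub>j \<noteq> l, k\<^esub>)\<close>: first \<open>l\<close>, then the other agents in increasing order.
\<close>

definition slot :: "nat \<Rightarrow> nat \<Rightarrow> nat \<Rightarrow> 'm::{finite,linorder} \<Rightarrow> nat" where
  "slot n l k r = (l # sorted_list_of_set ({1..n} - {l, k})) ! card {s. s < r}"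

definition tuple_of :: "nat \<Rightarrow> nat \<Rightarrow> nat \<Rightarrow> (nat \<Rightarrow> real) \<Rightarrow> real ^ 'm::{finite,linorder}" where
  "tuple_of n l k v = (\<chi> r. v (slot n l k r))"

definition family_of :: "nat \<Rightarrow> nat \<Rightarrow> nat \<Rightarrow> real ^ 'm::{finite,linorder} \<Rightarrow> nat \<Rightarrow> real" where
  "family_of n l k z j = z $ (inv (slot n l k) j)"

lemma bij_betw_card_less:
  "bij_betw (\<lambda>r::'m::{finite,linorder}. card {s. s < r}) UNIV {..<CARD('m)}"
proof -
  have mono: "card {s. s < r} < card {s. s < r'}" if "r < r'" for r r' :: 'm
    using that by (intro psubset_card_mono) auto
  have inj: "inj (\<lambda>r::'m. card {s. s < r})"
    by (rule linorder_injI) (use mono in force)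
  moreover have "card {s. s < r} < CARD('m)" for r :: 'm
    by (intro psubset_card_mono) auto
  ultimately show ?thesis
    by (intro bij_betw_imageI card_subset_eq) (auto simp: card_image)
qed

lemma bij_betw_slot:
  assumes "CARD('m::{finite,linorder}) + 1 = n" "l \<in> {1..n}" "k \<in> {1..n}" "l \<noteq> k"
  shows "bij_betw (slot n l k :: 'm \<Rightarrow> nat) UNIV ({1..n} - {k})"
proof -
  let ?L = "l # sorted_list_of_set ({1..n} - {l, k})"
  have "card ({1..n} - {l, k}) = n - 2"
    using assms by (simp add: card_Diff_subset)
  then have len: "length ?L = CARD('m)"
    using assms by auto
  have "bij_betw ((!) ?L) {..<length ?L} (set ?L)"
    by (rule bij_betw_nth) auto
  moreover have "set ?L = {1..n} - {k}"
    using assms by auto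
  ultimately have "bij_betw ((!) ?L) {..<CARD('m)} ({1..n} - {k})"
    using len by metis
  from bij_betw_trans[OF bij_betw_card_less this] show ?thesis
    by (simp add: slot_def[abs_def] comp_def)
qed

lemma family_of_tuple_of:
  assumes "CARD('m::{finite,linorder}) + 1 = n" "l \<in> {1..n}" "k \<in> {1..n}" "l \<noteq> k"
    and "j \<in> {1..n} - {k}"
  shows "family_of n l k (tuple_of n l k v :: real ^ 'm::{finite,linorder}) j = v j"
proof -
  have "j \<in> range (slot n l k :: 'm \<Rightarrow> nat)"
    using bij_betw_slot[OF assms(1-4)] assms(5) by (simp add: bij_betw_def)
  then show ?thesis
    by (simp add: family_of_def tuple_of_def f_inv_into_f)
qed

lemma tuple_of_family_of:
  fixes z :: "real ^ 'm::{finite,linorder}"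
  assumes "CARD('m::{finite,linorder}) + 1 = n" "l \<in> {1..n}" "k \<in> {1..n}" "l \<noteq> k"
  shows "tuple_of n l k (family_of n l k z) = z"
  using bij_betw_slot[OF assms] by (simp add: family_of_def tuple_of_def bij_betw_def vec_eq_iff)


section \<open>The Gaussian model and its formal posterior\<close>

definition links :: "nat \<Rightarrow> (nat \<times> nat) set" where
  "links n = {(j, m). j \<in> {1..n} \<and> m \<in> {1..n} \<and> j \<noteq> m}"

text \<open>
  Joint Lebesgue density of \<open>\<theta>\<close>, the \<open>x\<^sub>j = \<theta> + \<xi>\<^sub>j\<close> and the \<open>y\<^sub>j\<^sub>m = x\<^sub>j + \<zeta>\<^sub>j\<^sub>m\<close> (the latter at index
  \<open>(j, m)\<close>), with the flat prior density \<open>1\<close> for \<open>\<theta>\<close>.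
\<close>

definition joint_density ::
    "nat \<Rightarrow> real \<Rightarrow> real \<Rightarrow> real \<Rightarrow> (nat \<Rightarrow> real) \<Rightarrow> (nat \<times> nat \<Rightarrow> real) \<Rightarrow> real" where
  "joint_density n \<sigma> \<tau> \<theta> x y =
     (\<Prod>j\<in>{1..n}. normal_density \<theta> \<sigma> (x j)) * (\<Prod>(j, m)\<in>links n. normal_density (x j) \<tau> (y (j, m)))"

type_synonym state = "real \<times> (nat \<Rightarrow> real) \<times> (nat \<times> nat \<Rightarrow> real)"

text \<open>Lebesgue measure on the quantities not observed by agent \<open>i\<close>.\<close>

definition unobserved :: "nat \<Rightarrow> nat \<Rightarrow> state measure" where
  "unobserved n i =
     lborel \<Otimes>\<^sub>M (\<Pi>\<^sub>M j\<in>{1..n} - {i}. lborel) \<Otimes>\<^sub>M (\<Pi>\<^sub>M p\<in>{(j, m) \<in> links n. m \<noteq> i}. lborel)"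

text \<open>The joint density with agent \<open>i\<close>'s observation fixed to \<open>v\<close>.\<close>

definition slice_density ::
    "nat \<Rightarrow> real \<Rightarrow> real \<Rightarrow> nat \<Rightarrow> (nat \<Rightarrow> real) \<Rightarrow> state \<Rightarrow> real" where
  "slice_density n \<sigma> \<tau> i v = (\<lambda>(\<theta>, x, y).
     joint_density n \<sigma> \<tau> \<theta> (x(i := v i)) (\<lambda>(j, m). if m = i then v j else y (j, m)))"

definition posterior ::
    "nat \<Rightarrow> real \<Rightarrow> real \<Rightarrow> nat \<Rightarrow> (nat \<Rightarrow> real) \<Rightarrow> state measure" where
  "posterior n \<sigma> \<tau> i v = density (unobserved n i) (\<lambda>s. ennreal
     (slice_density n \<sigma> \<tau> i v s / (LINT s'|unobserved n i. slice_density n \<sigma> \<tau> i v s')))"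

fun observation :: "nat \<Rightarrow> state \<Rightarrow> nat \<Rightarrow> real" where
  "observation l (\<theta>, x, y) j = (if j = l then x l else y (j, l))"

text \<open>Conditional covariance matrix of \<open>(x\<^sub>l, {y\<^sub>j\<^sub>l}\<^bsub>j \<noteq> i, l\<^esub>)\<close> given \<open>y\<^sub>i = v\<close>.\<close>

definition cond_cov :: "nat \<Rightarrow> real \<Rightarrow> real \<Rightarrow> nat \<Rightarrow> nat \<Rightarrow> (nat \<Rightarrow> real)
    \<Rightarrow> real ^ 'm::{finite,linorder} ^ 'm::{finite,linorder}" where
  "cond_cov n \<sigma> \<tau> i l v =
     (let P = posterior n \<sigma> \<tau> i v; U = (\<lambda>r s. observation l s (slot n l i r))
      in \<chi> r r'. LINT s|P. (U r s - (LINT s'|P. U r s')) * (U r' s - (LINT s'|P. U r' s')))"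

definition centered_gaussian_density :: "real ^ 'm ^ 'm \<Rightarrow> real ^ 'm \<Rightarrow> real" where
  "centered_gaussian_density S z =
     exp (- (z \<bullet> (matrix_inv S *v z)) / 2) / sqrt ((2 * pi) ^ CARD('m) * det S)"


section \<open>The operator and the function space\<close>

text \<open>
  The family over \<open>{1..n}\<close> obtained from \<open>y\<^sub>i\<close> without its \<open>k\<close>-th entry by solving
  \<open>g (\<dots>) = a\<^sub>n x\<^sub>i + b\<^sub>n (\<Sum>j\<noteq>i. y\<^sub>j\<^sub>i)\<close> for the missing entry \<open>y\<^sub>k\<^sub>i\<close>.
\<close>

definition completion :: "nat \<Rightarrow> real \<Rightarrow> real \<Rightarrow> nat \<Rightarrow> nat \<Rightarrow> (real ^ 'm::{finite,linorder} \<Rightarrow> real)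
    \<Rightarrow> real ^ 'm::{finite,linorder} \<Rightarrow> nat \<Rightarrow> real" where
  "completion n \<sigma> \<tau> i k g y =
     (let v = family_of n i k y
      in v(k := g y / coef_b \<sigma> \<tau> n - coef_a \<sigma> \<tau> n / coef_b \<sigma> \<tau> n * v i - (\<Sum>j\<in>{1..n} - {k, i}. v j)))"

text \<open>
  One formula serves both \<open>x\<^sub>l\<close> (with \<open>j = l\<close>) and \<open>y\<^sub>j\<^sub>l\<close>, whose center does not depend on \<open>l\<close>.
\<close>

definition center :: "nat \<Rightarrow> real \<Rightarrow> real \<Rightarrow> nat \<Rightarrow> (nat \<Rightarrow> real) \<Rightarrow> nat \<Rightarrow> real" where
  "center n \<sigma> \<tau> i v j =
     coef_c \<sigma> \<tau> n * coef_a \<sigma> \<tau> (n - 1) * v i + coef_d \<sigma> \<tau> n * v j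
       + coef_c \<sigma> \<tau> n * coef_b \<sigma> \<tau> (n - 1) * (\<Sum>m\<in>{1..n} - {i, j}. v m)"

definition M_op :: "nat \<Rightarrow> real \<Rightarrow> real \<Rightarrow> nat \<Rightarrow> nat \<Rightarrow> real ^ 'm::{finite,linorder} \<Rightarrow> nat
    \<Rightarrow> (real ^ 'm::{finite,linorder} \<Rightarrow> real) \<Rightarrow> real ^ 'm::{finite,linorder} \<Rightarrow> real" where
  "M_op n \<sigma> \<tau> i k \<epsilon> l g y =
     (let v = completion n \<sigma> \<tau> i k g y;
          z = tuple_of n l i (center n \<sigma> \<tau> i v) + \<epsilon>;
          u = family_of n l i z
      in 1 / (coef_b \<sigma> \<tau> n * \<tau>) *
           (g z - coef_a \<sigma> \<tau> n * u l - coef_b \<sigma> \<tau> n * (\<Sum>j\<in>{1..n} - {i, l}. u j)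
              - coef_b \<sigma> \<tau> n * v i))"

text \<open>
  The noise density is taken with the conditional covariance at the completed observation; for
  this Gaussian model that covariance does not depend on the observed value.
\<close>

definition T_op :: "nat \<Rightarrow> real \<Rightarrow> real \<Rightarrow> nat \<Rightarrow> nat \<Rightarrow> (real ^ 'm::{finite,linorder} \<Rightarrow> real)
    \<Rightarrow> real ^ 'm::{finite,linorder} \<Rightarrow> real" where
  "T_op n \<sigma> \<tau> i k g y =
     1 + (\<Sum>l\<in>{1..n} - {i}. LINT \<epsilon>|lborel.
            cdf std_normal_distribution (M_op n \<sigma> \<tau> i k \<epsilon> l g y) *
            centered_gaussian_density (cond_cov n \<sigma> \<tau> i l (completion n \<sigma> \<tau> i k g y)) \<epsilon>)"

definition h_fun :: "nat \<Rightarrow> real \<Rightarrow> real \<Rightarrow> nat \<Rightarrow> nat \<Rightarrow> (real ^ 'm::{finite,linorder} \<Rightarrow> real)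
    \<Rightarrow> (nat \<Rightarrow> real) \<Rightarrow> real" where
  "h_fun n \<sigma> \<tau> i k g v =
     g (tuple_of n i k v) / coef_b \<sigma> \<tau> n - coef_a \<sigma> \<tau> n / coef_b \<sigma> \<tau> n * v i - (\<Sum>j\<in>{1..n} - {i}. v j)"

definition quasi_symmetric ::
    "nat \<Rightarrow> real \<Rightarrow> real \<Rightarrow> nat \<Rightarrow> nat \<Rightarrow> (real ^ 'm::{finite,linorder} \<Rightarrow> real) \<Rightarrow> bool" where
  "quasi_symmetric n \<sigma> \<tau> i k g \<longleftrightarrow>
     (let Z = {v \<in> {1..n} \<rightarrow>\<^sub>E UNIV. h_fun n \<sigma> \<tau> i k g v = 0}
      in \<forall>\<pi>. \<pi> permutes ({1..n} - {i}) \<longrightarrow> (\<lambda>v. v \<circ> \<pi>) ` Z = Z)"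

definition F_space ::
    "nat \<Rightarrow> real \<Rightarrow> real \<Rightarrow> nat \<Rightarrow> nat \<Rightarrow> (real ^ 'm::{finite,linorder} \<Rightarrow> real) set" where
  "F_space n \<sigma> \<tau> i k =
     {g. quasi_symmetric n \<sigma> \<tau> i k g \<and>
         (\<forall>y z. \<bar>g y - g z\<bar> \<le> coef_a \<sigma> \<tau> n * (\<Sum>r\<in>UNIV. \<bar>y $ r - z $ r\<bar>))}"

end

theory Submission
  imports Defs
begin

text \<open>
  There is no reason for \<open>T_op\<close> to preserve quasi-symmetry: \<open>T_op g\<close> is computed at the completion with respect to
  \<open>g\<close>, while the zero set of \<open>h_fun (T_op g)\<close> concerns the completion with respect to \<open>T_op g\<close>.
  It does preserve the larger space of Lipschitz functions that are symmetric in all coordinates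
  but the first. There \<open>w\<^sub>n < \<tau>\<close> makes \<open>T_op\<close> a contraction; as \<open>T_op\<close> takes values in \<open>[1, n]\<close>,
  sup-distances are finite after one step, although the functions themselves are unbounded.

  A fixed point \<open>h\<close> of this larger problem is quasi-symmetric after all. Write
  \<open>T_op h y = S h (completion h y)\<close>, where \<open>S h\<close> is a function of the whole observation that is symmetric
  in the \<open>y\<^sub>j\<^sub>i\<close>. By \<open>w\<^sub>n < \<tau>\<close> its Lipschitz constant in \<open>y\<^sub>k\<^sub>i\<close> is smaller than \<open>b\<^sub>n\<close>, so
  the zero set of \<open>h_fun h\<close> equals \<open>{v. S h v = a\<^sub>n x\<^sub>i + b\<^sub>n \<Sum> y\<^sub>j\<^sub>i}\<close>, which is visibly symmetric.

  What is needed about the noise covariance follows from symmetries of the posterior (translation by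
  its mean, relabelling of agents), without computing it.
\<close>

section \<open>Lebesgue measure under linear maps and Gaussian densities\<close>

text \<open>The larger space contains \<open>F_space\<close> because \<open>h_fun g\<close> is
  affine in \<open>y\<^sub>k\<^sub>i\<close> with slope \<open>- 1\<close>: its zero set is a graph
  over the tuples, so every tuple lifts to a zero, and invariance under those permutations that fix
  \<open>k\<close> becomes symmetry of \<open>g\<close> itself. The permutations that move
  \<open>k\<close> relate values of \<open>g\<close> at tuples depending on \<open>g\<close>; this
  part of quasi-symmetry has no counterpart in the larger space and is recovered only for the limit.

  The noise covariance is available only as an integral against a formal posterior. Three properties
  are extracted: it is the same for all observations, it follows a relabelling of the agents, and it
  is positive semidefinite. Nondegeneracy is left open, since a vanishing determinant turns the
  density into the zero function and all estimates need just a total mass of at most one. That mass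
  bound rests on a linear change of variables in \<open>real ^ 'n\<close>, where the development
  therefore starts.\<close>

lemma borel_measurable_vec_lambda:
  fixes f :: "'a \<Rightarrow> 'n::finite \<Rightarrow> real"
  assumes [measurable]: "\<And>j. (\<lambda>x. f x j) \<in> borel_measurable M"
  shows "(\<lambda>x. \<chi> j. f x j) \<in> borel_measurable M"
  by (subst borel_measurable_euclidean_space) (auto simp: Basis_vec_def inner_axis)

lemma measurable_PiM_lborel_reindex:
  fixes c :: "'a \<Rightarrow> real"
  assumes "bij_betw p I I"
  shows "(\<lambda>x. \<lambda>j\<in>I. x (p j) + c j) \<in> (\<Pi>\<^sub>M j\<in>I. lborel) \<rightarrow>\<^sub>M (\<Pi>\<^sub>M j\<in>I. lborel)"
proof (rule measurable_restrict)
  fix j assume "j \<in> I"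
  then have "p j \<in> I" using assms by (auto dest: bij_betwE)
  then show "(\<lambda>x. x (p j) + c j) \<in> (\<Pi>\<^sub>M j\<in>I. lborel) \<rightarrow>\<^sub>M lborel" by measurable
qed

text \<open>The preimage of a box is again a box, its side at \<open>p j\<close> being
  \<open>A j\<close> shifted by \<open>c j\<close>, so translation invariance in each factor and
  reindexing of the product suffice. Relabelling and translation are combined because both
  symmetries of the posterior have this form.\<close>

lemma distr_PiM_lborel_reindex:
  fixes c :: "'a \<Rightarrow> real"
  assumes I: "finite I" and p: "bij_betw p I I"
  shows "distr (\<Pi>\<^sub>M j\<in>I. lborel) (\<Pi>\<^sub>M j\<in>I. lborel) (\<lambda>x. \<lambda>j\<in>I. x (p j) + c j) = (\<Pi>\<^sub>M j\<in>I. lborel)"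
proof -
  interpret product_sigma_finite "\<lambda>_::'a. lborel :: real measure" ..
  have pI: "p j \<in> I" if "j \<in> I" for j
    using p that by (auto simp: bij_betw_def)
  note meas = measurable_PiM_lborel_reindex[OF p, of c]
  let ?q = "inv_into I p"
  have q: "?q j \<in> I" "p (?q j) = j" if "j \<in> I" for j
    using p that by (auto simp: bij_betw_def f_inv_into_f inv_into_into)
  have qp: "?q (p j) = j" if "j \<in> I" for j
    using p that by (auto simp: bij_betw_def)
  show ?thesis
  proof (rule PiM_eqI[OF I])
    fix A :: "'a \<Rightarrow> real set" assume A: "\<And>i. i \<in> I \<Longrightarrow> A i \<in> sets lborel"
    have "(\<lambda>x. \<lambda>j\<in>I. x (p j) + c j) -` Pi\<^sub>E I A \<inter> space (\<Pi>\<^sub>M j\<in>I. lborel)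
        = Pi\<^sub>E I (\<lambda>j. (\<lambda>y. y + c (?q j)) -` A (?q j))"
      (is "?L = ?R")
    proof (intro equalityI subsetI)
      fix x assume "x \<in> ?L"
      then have "x \<in> extensional I" and *: "\<And>j. j \<in> I \<Longrightarrow> x (p j) + c j \<in> A j"
        by (auto simp: space_PiM PiE_iff)
      then show "x \<in> ?R"
        using *[OF q(1)] q by (auto simp: PiE_iff)
    next
      fix x assume x: "x \<in> ?R"
      then have "x (p j) + c j \<in> A j" if "j \<in> I" for j
        using pI[OF that] qp[OF that] by (fastforce simp: PiE_iff)
      then show "x \<in> ?L"
        using x by (auto simp: space_PiM PiE_iff)
    qed
    then have "emeasure (distr (\<Pi>\<^sub>M j\<in>I. lborel) (\<Pi>\<^sub>M j\<in>I. lborel) (\<lambda>x. \<lambda>j\<in>I. x (p j) + c j)) (Pi\<^sub>E I A)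
        = emeasure (\<Pi>\<^sub>M j\<in>I. lborel) (Pi\<^sub>E I (\<lambda>j. (\<lambda>y. y + c (?q j)) -` A (?q j)))"
      using A I by (subst emeasure_distr[OF meas]) (auto intro!: sets_PiM_I_finite)
    also have "\<dots> = (\<Prod>j\<in>I. emeasure lborel ((\<lambda>y. y + c (?q j)) -` A (?q j)))"
      using A I q by (intro emeasure_PiM) (auto intro!: measurable_sets_borel[where M=borel])
    also have "\<dots> = (\<Prod>j\<in>I. emeasure lborel (A (?q j)))"
    proof (intro prod.cong refl)
      fix j assume "j \<in> I"
      then have "A (?q j) \<in> sets borel" using A q by auto
      moreover have comm: "(\<lambda>y. y + c (?q j)) = (+) (c (?q j))"
        by (auto simp: add.commute)
      ultimately show "emeasure lborel ((\<lambda>y. y + c (?q j)) -` A (?q j)) = emeasure lborel (A (?q j))"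
        by (subst (2) lborel_distr_plus[symmetric, of "c (?q j)"])
          (simp add: emeasure_distr comm)
    qed
    also have "\<dots> = (\<Prod>j\<in>I. emeasure lborel (A j))"
      using bij_betw_inv_into[OF p] by (rule prod.reindex_bij_betw)
    finally show "emeasure (distr (\<Pi>\<^sub>M j\<in>I. lborel) (\<Pi>\<^sub>M j\<in>I. lborel) (\<lambda>x. \<lambda>j\<in>I. x (p j) + c j)) (Pi\<^sub>E I A)
        = (\<Prod>j\<in>I. emeasure lborel (A j))" .
  qed simp
qed

text \<open>Boxes with ordered corners characterise \<open>lborel\<close>. The identification gives
  access to Fubini in a single coordinate and to permutations of the coordinates.\<close>

lemma lborel_vec_eq_distr:
  "(lborel :: (real ^ 'n) measure) = distr (\<Pi>\<^sub>M j\<in>UNIV. lborel) borel (\<lambda>f. \<chi> j. f j)"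
proof (rule lborel_eqI)
  interpret product_sigma_finite "\<lambda>_::'n. lborel :: real measure" ..
  have meas: "(\<lambda>f. \<chi> j. f j) \<in> (\<Pi>\<^sub>M j\<in>(UNIV::'n set). (lborel :: real measure)) \<rightarrow>\<^sub>M borel"
    by (rule borel_measurable_vec_lambda) measurable
  fix l u :: "real ^ 'n" assume le: "\<And>b. b \<in> Basis \<Longrightarrow> l \<bullet> b \<le> u \<bullet> b"
  have "(\<lambda>f. \<chi> j. f j) -` box l u \<inter> space (\<Pi>\<^sub>M j\<in>UNIV. lborel) = Pi\<^sub>E UNIV (\<lambda>j. {l $ j<..<u $ j})"
    by (auto simp: mem_box_cart space_PiM PiE_iff)
  then have "emeasure (distr (\<Pi>\<^sub>M j\<in>UNIV. lborel) borel (\<lambda>f. \<chi> j. f j)) (box l u)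
      = (\<Prod>j\<in>UNIV. emeasure lborel {l $ j<..<u $ j})"
    using meas by (subst emeasure_distr) (auto simp: emeasure_PiM)
  also have "\<dots> = (\<Prod>j\<in>UNIV. ennreal (u $ j - l $ j))"
    using le by (intro prod.cong refl emeasure_lborel_Ioo)
      (auto simp: Basis_vec_def cart_eq_inner_axis)
  also have "\<dots> = ennreal (\<Prod>j\<in>UNIV. (u - l) \<bullet> axis j 1)"
    using le by (subst prod_ennreal) (auto simp: Basis_vec_def cart_eq_inner_axis inner_diff_left)
  also have "(\<Prod>j\<in>UNIV. (u - l) \<bullet> axis j 1) = (\<Prod>b\<in>Basis. (u - l) \<bullet> b)"
    by (rule prod.reindex_bij_betw[of "\<lambda>j. axis j 1", unfolded bij_betw_def])
      (auto simp: inj_on_def axis_eq_axis Basis_vec_def)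
  finally show "emeasure (distr (\<Pi>\<^sub>M j\<in>UNIV. lborel) borel (\<lambda>f. \<chi> j. f j)) (box l u)
      = (\<Prod>b\<in>Basis. (u - l) \<bullet> b)" .
qed simp

section \<open>Integration over \<open>real ^ 'n\<close> and linear changes of variables\<close>

lemma measurable_vec_lambda_PiM [measurable]:
  "(\<lambda>f. \<chi> j. f j) \<in> (\<Pi>\<^sub>M j\<in>(UNIV::'n::finite set). (lborel :: real measure)) \<rightarrow>\<^sub>M borel"
  by (rule borel_measurable_vec_lambda) measurable

lemma measurable_vec_permute [measurable]: "(\<lambda>x::real^'n. \<chi> r. x $ \<rho> r) \<in> borel_measurable borel"
  by (rule borel_measurable_vec_lambda) measurable

lemma nn_integral_lborel_vec:
  fixes g :: "real^'n \<Rightarrow> ennreal"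
  assumes [measurable]: "g \<in> borel_measurable borel"
  shows "(\<integral>\<^sup>+x. g x \<partial>lborel) = (\<integral>\<^sup>+f. g (\<chi> j. f j) \<partial>(\<Pi>\<^sub>M j\<in>(UNIV::'n::finite set). lborel))"
proof -
  have "integral\<^sup>N (distr (\<Pi>\<^sub>M j\<in>(UNIV::'n set). lborel) borel (\<lambda>f. \<chi> j. f j)) g
      = (\<integral>\<^sup>+f. g (\<chi> j. f j) \<partial>(\<Pi>\<^sub>M j\<in>(UNIV::'n set). lborel))"
    by (rule nn_integral_distr[OF measurable_vec_lambda_PiM]) simp
  then show ?thesis
    by (simp flip: lborel_vec_eq_distr)
qed

lemma lborel_distr_vec_permute:
  assumes "bij (\<rho> :: 'n \<Rightarrow> 'n)"
  shows "distr lborel borel (\<lambda>x::real^'n. \<chi> r. x $ \<rho> r) = lborel"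
proof -
  let ?P = "\<Pi>\<^sub>M j\<in>(UNIV::'n set). (lborel :: real measure)"
  note m = measurable_PiM_lborel_reindex[OF assms, of "\<lambda>_. 0"]
  have "distr lborel borel (\<lambda>x::real^'n. \<chi> r. x $ \<rho> r) = distr ?P borel (\<lambda>f. \<chi> r. f (\<rho> r))"
    by (subst lborel_vec_eq_distr, subst distr_distr) (auto simp: comp_def)
  also have "\<dots> = distr (distr ?P ?P (\<lambda>x. \<lambda>j\<in>UNIV. x (\<rho> j) + 0)) borel (\<lambda>f. \<chi> j. f j)"
    using m by (subst distr_distr) (auto simp: comp_def restrict_UNIV)
  also have "\<dots> = lborel"
    using assms by (subst distr_PiM_lborel_reindex) (auto simp: lborel_vec_eq_distr)
  finally show ?thesis .
qed

text \<open>Fubini with coordinate \<open>m\<close> innermost: once the other coordinates are fixed,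
  among them \<open>x $ n\<close>, the shear translates coordinate \<open>m\<close> by a constant,
  which Lebesgue measure on the line does not see.\<close>

lemma nn_integral_lborel_shear:
  assumes mn: "m \<noteq> (n::'n)" and [measurable]: "g \<in> borel_measurable (borel :: (real^'n) measure)"
  shows "(\<integral>\<^sup>+x. g (\<chi> i. if i = m then x $ m + x $ n else x $ i) \<partial>lborel) = (\<integral>\<^sup>+x. g x \<partial>lborel)"
proof -
  interpret product_sigma_finite "\<lambda>_::'n. lborel :: real measure" ..
  let ?S = "\<lambda>x::real^'n. \<chi> i. if i = m then x $ m + x $ n else x $ i"
  have [measurable]: "?S \<in> borel \<rightarrow>\<^sub>M borel"
    by (rule borel_measurable_vec_lambda) measurable
  let ?N = "\<Pi>\<^sub>M j\<in>UNIV - {m}. lborel :: real measure"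
  have fubini: "(\<integral>\<^sup>+x. h x \<partial>lborel) = (\<integral>\<^sup>+f. (\<integral>\<^sup>+y. h (\<chi> j. (f(m := y)) j) \<partial>lborel) \<partial>?N)"
    if [measurable]: "h \<in> borel_measurable (borel :: (real^'n) measure)" for h
  proof -
    have m: "(\<lambda>f. h (\<chi> j. f j)) \<in> borel_measurable (\<Pi>\<^sub>M j\<in>insert m (UNIV - {m}). lborel)"
      by simp
    have "(\<integral>\<^sup>+x. h x \<partial>lborel) = (\<integral>\<^sup>+f. h (\<chi> j. f j) \<partial>(\<Pi>\<^sub>M j\<in>insert m (UNIV - {m}). lborel))"
      by (simp add: nn_integral_lborel_vec)
    also have "\<dots> = (\<integral>\<^sup>+f. (\<integral>\<^sup>+y. h (\<chi> j. (f(m := y)) j) \<partial>lborel) \<partial>?N)"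
      by (rule product_nn_integral_insert[OF _ _ m]) auto
    finally show ?thesis .
  qed
  have "(\<integral>\<^sup>+x. g (?S x) \<partial>lborel) = (\<integral>\<^sup>+f. (\<integral>\<^sup>+y. g (\<chi> j. (f(m := f n + y)) j) \<partial>lborel) \<partial>?N)"
    using mn by (subst fubini) (auto intro!: nn_integral_cong arg_cong[of _ _ g] simp: vec_eq_iff)
  also have "\<dots> = (\<integral>\<^sup>+f. (\<integral>\<^sup>+y. g (\<chi> j. (f(m := y)) j) \<partial>lborel) \<partial>?N)"
  proof (rule nn_integral_cong)
    fix f :: "'n \<Rightarrow> real"
    have [measurable]: "(\<lambda>y. g (\<chi> j. (f(m := y)) j)) \<in> borel_measurable borel"
      by (rule measurable_compose[OF borel_measurable_vec_lambda]) (auto simp: fun_upd_def)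
    show "(\<integral>\<^sup>+y. g (\<chi> j. (f(m := f n + y)) j) \<partial>lborel) = (\<integral>\<^sup>+y. g (\<chi> j. (f(m := y)) j) \<partial>lborel)"
      by (subst (2) lborel_distr_plus[symmetric, of "f n"], subst nn_integral_distr) auto
  qed
  also have "\<dots> = (\<integral>\<^sup>+x. g x \<partial>lborel)"
    by (simp add: fubini)
  finally show ?thesis .
qed

lemma nn_integral_lborel_diagonal:
  fixes g :: "real^'n \<Rightarrow> ennreal"
  assumes c: "\<And>i. c i \<noteq> 0" and [measurable]: "g \<in> borel_measurable borel"
  shows "ennreal (\<Prod>i\<in>UNIV. \<bar>c i\<bar>) * (\<integral>\<^sup>+x. g (\<chi> i. c i * x $ i) \<partial>lborel) = (\<integral>\<^sup>+x. g x \<partial>lborel)"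
proof -
  \<comment> \<open>\<open>lborel_affine_euclidean\<close> indexes its scale factors by basis
    vectors. \<open>?c\<close> is the linear extension of \<open>c\<close>, with value
    \<open>c j\<close> at \<open>axis j 1\<close>.\<close>
  let ?c = "\<lambda>b::real^'n. \<Sum>i\<in>UNIV. c i * b $ i"
  have cb: "?c (axis j 1) = c j" for j
    by (simp add: axis_def if_distrib cong: if_cong)
  have T: "0 + (\<Sum>j\<in>Basis. (?c j * (x \<bullet> j)) *\<^sub>R j) = (\<chi> i. c i * x $ i)" for x :: "real^'n"
  proof -
    have "(\<Sum>j\<in>Basis. (?c j * (x \<bullet> j)) *\<^sub>R j) = (\<Sum>j\<in>UNIV. (?c (axis j 1) * (x \<bullet> axis j 1)) *\<^sub>R axis j 1)"
      by (rule sum.reindex_bij_betw[of "\<lambda>j. axis j 1", unfolded bij_betw_def, symmetric])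
        (auto simp: inj_on_def axis_eq_axis Basis_vec_def)
    also have "\<dots> = (\<chi> i. c i * x $ i)"
      unfolding cb by (simp add: vec_eq_iff inner_axis) (simp add: axis_def if_distrib cong: if_cong)
    finally show ?thesis by simp
  qed
  have [measurable]: "(\<lambda>x::real^'n. \<chi> i. c i * x $ i) \<in> borel \<rightarrow>\<^sub>M borel"
    by (rule borel_measurable_vec_lambda) measurable
  have P: "(\<Prod>j\<in>Basis. \<bar>?c j\<bar>) = (\<Prod>i\<in>UNIV. \<bar>c i\<bar>)"
    by (subst prod.reindex_bij_betw[of "\<lambda>j. axis j 1", unfolded bij_betw_def, symmetric])
      (auto simp: inj_on_def axis_eq_axis Basis_vec_def cb)
  have "lborel = density (distr lborel borel (\<lambda>x::real^'n. 0 + (\<Sum>j\<in>Basis. (?c j * (x \<bullet> j)) *\<^sub>R j)))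
      (\<lambda>_. (\<Prod>j\<in>Basis. \<bar>?c j\<bar>))"
    by (rule lborel_affine_euclidean) (use c in \<open>auto simp: Basis_vec_def cb\<close>)
  then have "lborel = density (distr lborel borel (\<lambda>x::real^'n. \<chi> i. c i * x $ i)) (\<lambda>_. (\<Prod>i\<in>UNIV. \<bar>c i\<bar>))"
    unfolding T P .
  then have "(\<integral>\<^sup>+x. g x \<partial>lborel) =
      (\<integral>\<^sup>+x. g x \<partial>density (distr lborel borel (\<lambda>x::real^'n. \<chi> i. c i * x $ i)) (\<lambda>_. (\<Prod>i\<in>UNIV. \<bar>c i\<bar>)))"
    by (rule arg_cong)
  then show ?thesis
    by (simp add: nn_integral_density nn_integral_distr nn_integral_cmult)
qed

text \<open>Every linear map is composed of coordinate swaps, shears, diagonal maps and maps with a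
  zero row, and the formula passes to composites because determinants multiply.\<close>

lemma nn_integral_lborel_linear:
  fixes f :: "real^'n \<Rightarrow> real^'n"
  assumes "linear f" "det (matrix f) \<noteq> 0" "g \<in> borel_measurable borel"
  shows "ennreal \<bar>det (matrix f)\<bar> * (\<integral>\<^sup>+x. g (f x) \<partial>lborel) = (\<integral>\<^sup>+x. g x \<partial>lborel)"
proof -
  \<comment> \<open>Nonsingularity is a premise inside \<open>P\<close>: a map with a zero row then
    satisfies \<open>P\<close> trivially, and a nonsingular composite hands the premise on to both
    factors.\<close>
  define P where "P f \<longleftrightarrow> (det (matrix f) \<noteq> 0 \<longrightarrow> (\<forall>g\<in>borel_measurable borel.
     ennreal \<bar>det (matrix f)\<bar> * (\<integral>\<^sup>+x. g (f x) \<partial>lborel) = (\<integral>\<^sup>+x. g x \<partial>lborel)))"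
    for f :: "real^'n \<Rightarrow> real^'n"
  have "P f"
    using \<open>linear f\<close>
  proof (rule induct_linear_elementary)
    fix f h :: "real^'n \<Rightarrow> real^'n" assume fh: "linear f" "linear h" "P f" "P h"
    show "P (f \<circ> h)"
      unfolding P_def
    proof (intro impI ballI)
      fix g :: "real^'n \<Rightarrow> ennreal" assume g[measurable]: "g \<in> borel_measurable borel"
      have [measurable]: "f \<in> borel_measurable borel"
        using fh(1) by (simp add: borel_measurable_continuous_onI linear_continuous_on linear_linear)
      assume "det (matrix (f \<circ> h)) \<noteq> 0"
      then have nz: "det (matrix f) \<noteq> 0" "det (matrix h) \<noteq> 0"
        using fh by (auto simp: matrix_compose det_mul)
      have "ennreal \<bar>det (matrix (f \<circ> h))\<bar> * (\<integral>\<^sup>+x. g ((f \<circ> h) x) \<partial>lborel)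
          = ennreal \<bar>det (matrix f)\<bar> * (ennreal \<bar>det (matrix h)\<bar> * (\<integral>\<^sup>+x. (\<lambda>y. g (f y)) (h x) \<partial>lborel))"
        using fh by (simp add: matrix_compose det_mul abs_mult ennreal_mult mult.assoc)
      also have "\<dots> = ennreal \<bar>det (matrix f)\<bar> * (\<integral>\<^sup>+x. g (f x) \<partial>lborel)"
      proof -
        have "(\<lambda>y. g (f y)) \<in> borel_measurable borel" by measurable
        then show ?thesis
          using fh(4)[unfolded P_def, rule_format, OF nz(2), of "\<lambda>y. g (f y)"] by simp
      qed
      also have "\<dots> = (\<integral>\<^sup>+x. g x \<partial>lborel)"
        using fh(3) nz g unfolding P_def by blast
      finally show "ennreal \<bar>det (matrix (f \<circ> h))\<bar> * (\<integral>\<^sup>+x. g ((f \<circ> h) x) \<partial>lborel) = (\<integral>\<^sup>+x. g x \<partial>lborel)" .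
    qed
  next
    fix f :: "real^'n \<Rightarrow> real^'n" and i assume "\<And>x. f x $ i = 0"
    then have "row i (matrix f) = 0"
      by (simp add: row_def matrix_def vec_eq_iff)
    then show "P f"
      by (auto simp: P_def dest: det_zero_row)
  next
    fix c :: "'n \<Rightarrow> real"
    have "det (matrix (\<lambda>x::real^'n. \<chi> i. c i * x $ i)) = (\<Prod>i\<in>UNIV. c i)"
      by (subst det_diagonal) (auto simp: matrix_def axis_def)
    then show "P (\<lambda>x. \<chi> i. c i * x $ i)"
      unfolding P_def by (auto simp: nn_integral_lborel_diagonal abs_prod)
  next
    fix m n :: 'n assume mn: "m \<noteq> n"
    have "matrix (\<lambda>x::real^'n. \<chi> i. x $ Transposition.transpose m n i)
        = (\<chi> i. mat 1 $ Transposition.transpose m n i)"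
      by (auto simp: matrix_def mat_def axis_def vec_eq_iff)
    then have "\<bar>det (matrix (\<lambda>x::real^'n. \<chi> i. x $ Transposition.transpose m n i))\<bar> = 1"
      using mn by (simp add: det_permute_rows permutes_swap_id sign_swap_id)
    moreover have "(\<integral>\<^sup>+x. g (\<chi> i. x $ Transposition.transpose m n i) \<partial>lborel) = (\<integral>\<^sup>+x. g x \<partial>lborel)"
      if [measurable]: "g \<in> borel_measurable borel" for g :: "real^'n \<Rightarrow> ennreal"
      by (subst (2) lborel_distr_vec_permute[symmetric, of "Transposition.transpose m n"])
        (auto simp: nn_integral_distr)
    ultimately show "P (\<lambda>x. \<chi> i. x $ Transposition.transpose m n i)"
      by (simp add: P_def)
  next
    fix m n :: 'n assume mn: "m \<noteq> n"
    let ?f = "\<lambda>x::real^'n. \<chi> i. if i = m then x $ m + x $ n else x $ i"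
    have "matrix ?f = (\<chi> i. if i = m then row m (mat 1) + 1 *s row n (mat 1) else row i (mat 1))"
      using mn by (auto simp: matrix_def mat_def axis_def vec_eq_iff row_def)
    then have "det (matrix ?f) = 1"
      using mn by (simp add: det_row_operation del: scaleR_one)
    then show "P ?f"
      using mn by (simp add: P_def nn_integral_lborel_shear)
  qed
  then show ?thesis
    using assms by (simp add: P_def)
qed

text \<open>Gram-Schmidt by maximality: an \<open>S\<close>-orthonormal set of largest cardinality
  spans, as otherwise a vector outside its span could be made orthogonal to it and normalised. Its
  elements are the columns of \<open>A\<close>, which serves as the substitution that turns a
  Gaussian density into the standard one.\<close>

lemma orthonormal_wrt_form:
  fixes S :: "real^'n^'n"
  assumes sym: "transpose S = S" and pd: "\<And>x. x \<noteq> 0 \<Longrightarrow> x \<bullet> (S *v x) > 0"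
  shows "\<exists>A :: real^'n^'n. transpose A ** S ** A = mat 1"
proof -
  define on where "on B \<longleftrightarrow> finite B \<and> (\<forall>x\<in>B. \<forall>y\<in>B. x \<bullet> (S *v y) = (if x = y then 1 else 0))"
    for B :: "(real^'n) set"
  have symS: "x \<bullet> (S *v y) = y \<bullet> (S *v x)" for x y
    by (metis sym dot_lmul_matrix inner_commute transpose_matrix_vector)
  have ind: "independent B" if "on B" for B
  proof -
    have "finite B" using that by (simp add: on_def)
    moreover have "u v = 0" if "(\<Sum>v\<in>B. u v *\<^sub>R v) = 0" "v \<in> B" for u v
    proof -
      have "0 = v \<bullet> (S *v (\<Sum>w\<in>B. u w *\<^sub>R w))"
        using that by simp
      also have "\<dots> = (\<Sum>w\<in>B. u w * (v \<bullet> (S *v w)))"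
        by (simp add: linear_sum[OF matrix_vector_mul_linear] inner_sum_right matrix_vector_mult_scaleR)
      also have "\<dots> = u v"
      proof -
        have "u w * (v \<bullet> (S *v w)) = (if v = w then u w else 0)" if "w \<in> B" for w
          using \<open>on B\<close> \<open>v \<in> B\<close> that by (auto simp: on_def)
        then show ?thesis
          using that \<open>finite B\<close> by simp
      qed
      finally show ?thesis by simp
    qed
    ultimately show ?thesis
      by (auto simp: dependent_finite)
  qed
  have card_le: "card B \<le> CARD('n)" if "on B" for B
    using independent_bound[OF ind[OF that]] by simp
  have "on {}" by (simp add: on_def)
  then have "\<exists>B. on B \<and> (\<forall>B'. on B' \<longrightarrow> card B' \<le> card B)"
    by (rule ex_has_greatest_nat[where b="Suc CARD('n)"]) (simp add: card_le less_Suc_eq_le)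
  then obtain B where B: "on B" and max: "\<And>B'. on B' \<Longrightarrow> card B' \<le> card B"
    by blast
  have finB: "finite B" using B by (simp add: on_def)
  have "span B = UNIV"
  proof (rule ccontr)
    assume "span B \<noteq> UNIV"
    then obtain x where x: "x \<notin> span B" by auto
    define y where "y = x - (\<Sum>b\<in>B. (b \<bullet> (S *v x)) *\<^sub>R b)"
    have "(\<Sum>b\<in>B. (b \<bullet> (S *v x)) *\<^sub>R b) \<in> span B"
      by (intro span_sum span_scale span_base)
    then have ys: "y \<notin> span B"
      using x span_add[of y B "\<Sum>b\<in>B. (b \<bullet> (S *v x)) *\<^sub>R b"] by (auto simp: y_def)
    then have "y \<noteq> 0" using span_zero by metis
    then have pos: "y \<bullet> (S *v y) > 0" by (rule pd)
    have by0: "b \<bullet> (S *v y) = 0" if "b \<in> B" for b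
    proof -
      have "b \<bullet> (S *v y) = b \<bullet> (S *v x) - (\<Sum>w\<in>B. (w \<bullet> (S *v x)) * (b \<bullet> (S *v w)))"
        by (simp add: y_def matrix_vector_mult_diff_distrib inner_diff_right inner_sum_right
            linear_sum[OF matrix_vector_mul_linear] matrix_vector_mult_scaleR)
      also have "(\<Sum>w\<in>B. (w \<bullet> (S *v x)) * (b \<bullet> (S *v w))) = b \<bullet> (S *v x)"
      proof -
        have "(w \<bullet> (S *v x)) * (b \<bullet> (S *v w)) = (if b = w then w \<bullet> (S *v x) else 0)" if "w \<in> B" for w
          using B \<open>b \<in> B\<close> that by (auto simp: on_def)
        then show ?thesis
          using that finB by simp
      qed
      finally show ?thesis by simp
    qed
    define z where "z = (1 / sqrt (y \<bullet> (S *v y))) *\<^sub>R y"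
    have zz: "z \<bullet> (S *v z) = 1"
      using pos by (simp add: z_def matrix_vector_mult_scaleR)
    have bz: "b \<bullet> (S *v z) = 0" if "b \<in> B" for b
      using by0[OF that] by (simp add: z_def matrix_vector_mult_scaleR)
    have zb: "z \<bullet> (S *v b) = 0" if "b \<in> B" for b
      using bz[OF that] symS by metis
    have "z \<notin> B" using bz zz by force
    moreover have "on (insert z B)"
      using B zz bz zb \<open>z \<notin> B\<close> by (auto simp: on_def)
    ultimately show False
      using max[of "insert z B"] finB by simp
  qed
  then have "card B = CARD('n)"
    using dim_span_eq_card_independent[OF ind[OF B]] by simp
  then obtain u :: "'n \<Rightarrow> real^'n" where u: "bij_betw u UNIV B"
    using finite_same_card_bij[of "UNIV :: 'n set" B] finB by auto
  let ?A = "(\<chi> i j. u j $ i) :: real^'n^'n"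
  have "(transpose ?A ** S ** ?A) $ i $ j = u i \<bullet> (S *v u j)" for i j
    by (simp add: matrix_mul_assoc[symmetric])
      (simp add: matrix_matrix_mult_def matrix_vector_mult_def transpose_def inner_vec_def)
  moreover have "u i \<bullet> (S *v u j) = (if i = j then 1 else 0)" for i j
    using B u by (auto simp: on_def bij_betw_def inj_on_def)
  ultimately have "transpose ?A ** S ** ?A = mat 1"
    by (simp add: vec_eq_iff mat_def)
  then show ?thesis by blast
qed

section \<open>Mass, integrability and permutation symmetry of Gaussian densities\<close>

lemma nn_integral_std_normal_density: "(\<integral>\<^sup>+x. ennreal (std_normal_density x) \<partial>lborel) = 1"
proof -
  interpret prob_space "density lborel (\<lambda>x. ennreal (std_normal_density x))"
    by (rule prob_space_normal_density) simp
  show ?thesis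
    using emeasure_space_1 by (simp add: emeasure_density)
qed

lemma nn_integral_std_gaussian:
  "(\<integral>\<^sup>+x. ennreal (exp (- (x \<bullet> x) / 2) / sqrt ((2 * pi) ^ CARD('n))) \<partial>(lborel :: (real^'n) measure)) = 1"
proof -
  interpret product_sigma_finite "\<lambda>_::'n. lborel :: real measure" ..
  have "exp (- (x \<bullet> x) / 2) / sqrt ((2 * pi) ^ CARD('n)) = (\<Prod>i\<in>UNIV. std_normal_density (x $ i))"
    for x :: "real^'n"
  proof -
    have "(\<Prod>i\<in>UNIV. std_normal_density (x $ i))
        = (\<Prod>i\<in>(UNIV::'n set). 1 / sqrt (2 * pi)) * (\<Prod>i\<in>UNIV. exp (- (x $ i)\<^sup>2 / 2))"
      by (simp only: std_normal_density_def prod.distrib)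
    also have "\<dots> = (1 / sqrt (2 * pi)) ^ CARD('n) * exp (\<Sum>i\<in>UNIV. - (x $ i)\<^sup>2 / 2)"
      by (simp only: prod_constant exp_sum finite_class.finite_UNIV)
    also have "(1 / sqrt (2 * pi)) ^ CARD('n) = 1 / sqrt ((2 * pi) ^ CARD('n))"
      by (simp only: power_one_over real_sqrt_power)
    also have "(\<Sum>i\<in>UNIV. - (x $ i)\<^sup>2 / 2) = - (x \<bullet> x) / 2"
      by (simp add: inner_vec_def power2_eq_square sum_negf sum_divide_distrib)
    finally show ?thesis by simp
  qed
  then have "(\<integral>\<^sup>+x. ennreal (exp (- (x \<bullet> x) / 2) / sqrt ((2 * pi) ^ CARD('n))) \<partial>(lborel :: (real^'n) measure))
      = (\<integral>\<^sup>+x. (\<Prod>i\<in>UNIV. ennreal (std_normal_density (x $ i))) \<partial>(lborel :: (real^'n) measure))"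
    by (simp add: prod_ennreal)
  also have "\<dots> = (\<integral>\<^sup>+f. (\<Prod>i\<in>UNIV. ennreal (std_normal_density (f i))) \<partial>(\<Pi>\<^sub>M j\<in>(UNIV::'n set). lborel))"
    by (subst nn_integral_lborel_vec) auto
  also have "\<dots> = (\<Prod>i\<in>(UNIV::'n set). (\<integral>\<^sup>+x. ennreal (std_normal_density x) \<partial>lborel))"
    by (rule product_nn_integral_prod) auto
  finally show ?thesis
    by (simp add: nn_integral_std_normal_density)
qed

lemma matrix_inv_cancel:
  fixes A :: "real^'n^'n"
  assumes "det A \<noteq> 0"
  shows matrix_inv_right_cancel: "A ** matrix_inv A = mat 1"
    and matrix_inv_left_cancel: "matrix_inv A ** A = mat 1"
proof -
  have "\<exists>B. A ** B = mat 1 \<and> B ** A = mat 1"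
    using assms by (metis invertible_det_nz invertible_def)
  then have "A ** matrix_inv A = mat 1 \<and> matrix_inv A ** A = mat 1"
    unfolding matrix_inv_def by (rule someI_ex)
  then show "A ** matrix_inv A = mat 1" "matrix_inv A ** A = mat 1" by auto
qed

lemma measurable_matrix_vector_mult [measurable]:
  "(\<lambda>x. (A::real^'n^'m) *v x) \<in> borel_measurable borel"
  by (intro borel_measurable_continuous_onI linear_continuous_on linear_conv_bounded_linear[THEN iffD1])
    (rule matrix_vector_mul_linear)

lemma measurable_centered_gaussian_density [measurable]:
  "centered_gaussian_density S \<in> borel_measurable borel"
  unfolding centered_gaussian_density_def[abs_def] by measurable

text \<open>If \<open>det S = 0\<close>, division by zero makes the density vanish identically,
  hence a bound on the mass instead of an equation. Otherwise the substitution by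
  \<open>transpose A\<close>, with \<open>A\<close> from \<open>orthonormal_wrt_form\<close>,
  produces the standard density, and its Jacobian accounts for the determinant of
  \<open>S\<close>.\<close>

lemma centered_gaussian_density_psd:
  fixes S :: "real^'n^'n"
  assumes sym: "transpose S = S" and psd: "\<And>x. x \<bullet> (S *v x) \<ge> 0"
  shows "centered_gaussian_density S z \<ge> 0"
    and "(\<integral>\<^sup>+z. ennreal (centered_gaussian_density S z) \<partial>lborel) \<le> 1"
proof -
  have "centered_gaussian_density S z \<ge> 0 \<and>
      (\<integral>\<^sup>+z. ennreal (centered_gaussian_density S z) \<partial>lborel) \<le> 1"
  proof (cases "det S = 0")
    case True
    then show ?thesis by (simp add: centered_gaussian_density_def)
  next
    case False
    \<comment> \<open>A nonsingular semidefinite form is definite: if it vanished at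
      \<open>x\<close>, moving from \<open>x\<close> against \<open>w\<close>, the image of
      \<open>x\<close> under \<open>S\<close>, would make it negative, the change being linear in
      the step \<open>t\<close> with slope \<open>- 2 * (w \<bullet> w)\<close> up to a quadratic
      remainder.\<close>
    have pos: "x \<bullet> (S *v x) > 0" if "x \<noteq> 0" for x
    proof (rule ccontr)
      assume "\<not> x \<bullet> (S *v x) > 0"
      then have 0: "x \<bullet> (S *v x) = 0" using psd[of x] by simp
      define w where "w = S *v x"
      define q where "q = w \<bullet> (S *v w)"
      have "w \<noteq> 0"
        using False that by (metis invertible_det_nz matrix_left_invertible_ker invertible_left_inverse w_def)
      then have w: "w \<bullet> w > 0" by simp
      have "x \<bullet> (S *v w) = w \<bullet> w"
        unfolding w_def by (metis sym dot_lmul_matrix transpose_matrix_vector)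
      then have "0 \<le> - 2 * t * (w \<bullet> w) + t\<^sup>2 * q" for t
        using psd[of "x - t *\<^sub>R w"] 0
        by (simp add: matrix_vector_mult_diff_distrib matrix_vector_mult_scaleR inner_diff_left
            inner_diff_right w_def[symmetric] q_def[symmetric] power2_eq_square algebra_simps)
      \<comment> \<open>This step keeps the quadratic term below half the size of the linear one;
        the summand one keeps the denominator positive when \<open>q\<close> is zero.\<close>
      note * = this[of "w \<bullet> w / (\<bar>q\<bar> + 1)"]
      have "q / (\<bar>q\<bar> + 1) < 1" by (auto simp: divide_less_eq)
      have "(w \<bullet> w / (\<bar>q\<bar> + 1))\<^sup>2 * q = (w \<bullet> w)\<^sup>2 / (\<bar>q\<bar> + 1) * (q / (\<bar>q\<bar> + 1))"
        by (simp add: power2_eq_square)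
      also have "\<dots> < (w \<bullet> w)\<^sup>2 / (\<bar>q\<bar> + 1) * 1"
        using w \<open>q / (\<bar>q\<bar> + 1) < 1\<close> by (intro mult_strict_left_mono) auto
      finally have "(w \<bullet> w / (\<bar>q\<bar> + 1))\<^sup>2 * q < (w \<bullet> w)\<^sup>2 / (\<bar>q\<bar> + 1)" by simp
      moreover have "- 2 * (w \<bullet> w / (\<bar>q\<bar> + 1)) * (w \<bullet> w) = - 2 * ((w \<bullet> w)\<^sup>2 / (\<bar>q\<bar> + 1))"
        by (simp add: power2_eq_square)
      moreover have "(w \<bullet> w)\<^sup>2 / (\<bar>q\<bar> + 1) > 0"
        using w by auto
      ultimately show False
        using * by linarith
    qed
    obtain A :: "real^'n^'n" where A: "transpose A ** S ** A = mat 1"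
      using orthonormal_wrt_form[OF sym pos] by blast
    have "det (transpose A ** S ** A) = 1" using A by simp
    then have detA: "det A * det A * det S = 1"
      by (simp add: det_mul algebra_simps)
    then have "det A \<noteq> 0" by auto
    have dS: "det S = 1 / (det A)\<^sup>2"
      using detA \<open>det A \<noteq> 0\<close> by (simp add: power2_eq_square field_simps)
    \<comment> \<open>A one-sided inverse of a square matrix is two-sided. This brings both factors
      to the same side of \<open>S\<close> and so identifies \<open>matrix_inv S\<close>.\<close>
    have "A ** (transpose A ** S) = mat 1"
      using A matrix_left_right_inverse by blast
    then have "transpose (A ** (transpose A ** S)) = transpose (mat 1)" by simp
    then have "S ** (A ** transpose A) = mat 1"
      by (simp add: matrix_transpose_mul sym matrix_mul_assoc)
    then have inv: "matrix_inv S = A ** transpose A"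
      using False by (metis matrix_inv_left_cancel matrix_mul_assoc matrix_mul_lid matrix_mul_rid)
    let ?g = "\<lambda>x::real^'n. exp (- (x \<bullet> x) / 2) / sqrt ((2 * pi) ^ CARD('n))"
    have *: "centered_gaussian_density S z = \<bar>det A\<bar> * ?g (transpose A *v z)" for z
    proof -
      have "z \<bullet> (matrix_inv S *v z) = (transpose A *v z) \<bullet> (transpose A *v z)"
        unfolding inv by (metis dot_lmul_matrix matrix_vector_mul_assoc transpose_matrix_vector transpose_transpose)
      then show ?thesis
        by (simp add: centered_gaussian_density_def dS real_sqrt_divide)
    qed
    have "(\<integral>\<^sup>+z. ennreal (centered_gaussian_density S z) \<partial>lborel)
        = ennreal \<bar>det A\<bar> * (\<integral>\<^sup>+z. ennreal (?g (transpose A *v z)) \<partial>lborel)"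
      unfolding * by (subst nn_integral_cmult[symmetric]) (auto simp only: ennreal_mult' abs_ge_zero, measurable)
    also have "\<dots> = (\<integral>\<^sup>+z. ennreal (?g z) \<partial>lborel)"
      using nn_integral_lborel_linear[of "(*v) (transpose A)" "\<lambda>z. ennreal (?g z)"] \<open>det A \<noteq> 0\<close>
      by simp
    finally show ?thesis
      using * nn_integral_std_gaussian[where 'n='n] by simp
  qed
  then show "centered_gaussian_density S z \<ge> 0"
    and "(\<integral>\<^sup>+z. ennreal (centered_gaussian_density S z) \<partial>lborel) \<le> 1" by auto
qed

lemma integrable_centered_gaussian_density:
  fixes S :: "real^'n^'n"
  assumes sym: "transpose S = S" and psd: "\<And>x. x \<bullet> (S *v x) \<ge> 0"
  shows "integrable lborel (centered_gaussian_density S)"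
    and "(LINT z|lborel. centered_gaussian_density S z) \<le> 1"
proof -
  note n = centered_gaussian_density_psd[OF assms]
  show I: "integrable lborel (centered_gaussian_density S)"
    using n by (intro integrableI_nonneg) (auto intro: le_less_trans)
  show "(LINT z|lborel. centered_gaussian_density S z) \<le> 1"
    using n nn_integral_eq_integral[OF I] by simp
qed

text \<open>Reordering coordinates conjugates the covariance by a permutation matrix: the sign
  enters the determinant once for rows and once for columns, and the inverse is reordered in the
  same way. In the singular case both densities are zero.\<close>

lemma centered_gaussian_density_permute:
  fixes S S' :: "real^'n^'n"
  assumes \<rho>: "bij \<rho>" and S: "\<And>r r'. S' $ \<rho> r $ \<rho> r' = S $ r $ r'"
  shows "centered_gaussian_density S (\<chi> r. z $ \<rho> r) = centered_gaussian_density S' z"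
proof -
  have perm: "\<rho> permutes UNIV" by (rule bij_imp_permutes[OF \<rho>]) auto
  have "S = (\<chi> r. (\<chi> i j. S' $ i $ \<rho> j) $ \<rho> r)"
    by (simp add: vec_eq_iff S)
  then have "det S = of_int (sign \<rho>) * (of_int (sign \<rho>) * det S')"
    using det_permute_rows[OF perm, of "\<chi> i j. S' $ i $ \<rho> j"] det_permute_columns[OF perm, of S'] by simp
  also have "\<dots> = det S'"
    by (simp add: sign_def)
  finally have det: "det S = det S'" .
  show ?thesis
  proof (cases "det S = 0")
    case True
    then show ?thesis using det by (simp add: centered_gaussian_density_def)
  next
    case False
    let ?P = "\<lambda>z::real^'n. \<chi> r. z $ \<rho> r"
    have mv: "S *v (?P z) = ?P (S' *v z)" for z
      unfolding matrix_vector_mult_def vec_eq_iff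
      using sum.reindex_bij_betw[OF \<rho>, of "\<lambda>j. S' $ \<rho> _ $ j * z $ j"] by (simp add: S)
    have "S' ** matrix_inv S' = mat 1" "matrix_inv S ** S = mat 1"
      using False det by (simp_all add: matrix_inv_cancel)
    then have "matrix_inv S *v (?P z) = matrix_inv S *v (?P (S' *v (matrix_inv S' *v z)))"
      by (simp add: matrix_vector_mul_assoc)
    also have "\<dots> = ?P (matrix_inv S' *v z)"
      unfolding mv[symmetric] using \<open>matrix_inv S ** S = mat 1\<close> by (simp add: matrix_vector_mul_assoc)
    finally have "matrix_inv S *v (?P z) = ?P (matrix_inv S' *v z)" .
    then have "?P z \<bullet> (matrix_inv S *v ?P z) = z \<bullet> (matrix_inv S' *v z)"
      using sum.reindex_bij_betw[OF \<rho>, of "\<lambda>r. z $ r * (matrix_inv S' *v z) $ r"]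
      by (simp add: inner_vec_def)
    then show ?thesis
      by (simp add: centered_gaussian_density_def det)
  qed
qed

section \<open>Symmetries of the posterior\<close>

lemma integrable_pair_mult:
  fixes f :: "'a \<Rightarrow> real" and g :: "'b \<Rightarrow> real"
  assumes "sigma_finite_measure M" "sigma_finite_measure N" and f: "integrable M f" and g: "integrable N g"
  shows "integrable (M \<Otimes>\<^sub>M N) (\<lambda>(x, y). f x * g y)"
proof -
  interpret pair_sigma_finite M N using assms by (simp add: pair_sigma_finite_def)
  note [measurable] = borel_measurable_integrable[OF f] borel_measurable_integrable[OF g]
  show ?thesis
    using f g by (intro Fubini_integrable) (auto simp: abs_mult)
qed

section \<open>The posterior density of one observer as the exponential of a quadratic
  energy\<close>

locale observer =
  fixes n i :: nat and \<sigma> \<tau> :: real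
  assumes n_ge_2: "n \<ge> 2" and i_agent: "i \<in> {1..n}" and \<sigma>_pos: "\<sigma> > 0" and \<tau>_pos: "\<tau> > 0"
begin

definition others :: "nat set" where "others = {1..n} - {i}"
definition unseen :: "(nat \<times> nat) set" where "unseen = {(j, m) \<in> links n. m \<noteq> i}"

lemma finite_others [simp, intro]: "finite others" by (simp add: others_def)

lemma finite_unseen [simp, intro]: "finite unseen"
  by (rule finite_subset[of _ "{1..n} \<times> {1..n}"]) (auto simp: unseen_def links_def)

lemma unobserved_eq:
  "unobserved n i = lborel \<Otimes>\<^sub>M (\<Pi>\<^sub>M j\<in>others. lborel) \<Otimes>\<^sub>M (\<Pi>\<^sub>M p\<in>unseen. lborel)"
  by (simp add: unobserved_def others_def unseen_def)

text \<open>The mean of a link out of \<open>j\<close>. The observer's own signal is known, hence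
  read from \<open>v\<close> and not from the unobserved \<open>x\<close>.\<close>

definition signals :: "(nat \<Rightarrow> real) \<Rightarrow> (nat \<Rightarrow> real) \<Rightarrow> nat \<Rightarrow> real" where
  "signals v x j = (if j = i then v i else x j)"

text \<open>The negative logarithm of \<open>slice_density\<close> up to an additive constant. Links
  into the observer are fixed to the values \<open>v j\<close> and form the first sum with weight
  \<open>\<tau>\<close>.\<close>

fun energy :: "(nat \<Rightarrow> real) \<Rightarrow> state \<Rightarrow> real" where
  "energy v (\<theta>, x, y) =
     ((v i - \<theta>)\<^sup>2 + (\<Sum>j\<in>others. (x j - \<theta>)\<^sup>2)) / (2 * \<sigma>\<^sup>2) +
     ((\<Sum>j\<in>others. (v j - x j)\<^sup>2) + (\<Sum>p\<in>unseen. (y p - signals v x (fst p))\<^sup>2)) / (2 * \<tau>\<^sup>2)"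

text \<open>\<open>C\<close> is quantified before \<open>v\<close>: it collects the normalisations
  of the normal densities, which depend on the variances only. Slices at different observations can
  therefore be compared through their energies.\<close>

lemma slice_density_eq_exp:
  "\<exists>C>0. \<forall>v s. slice_density n \<sigma> \<tau> i v s = C * exp (- energy v s)"
proof -
  define c where "c s = 1 / sqrt (2 * pi * s\<^sup>2)" for s :: real
  define C where "C = (c \<sigma> * c \<sigma> ^ card others) * (c \<tau> ^ card others * c \<tau> ^ card unseen)"
  have agents: "{1..n} = insert i others" "i \<notin> others"
    using i_agent by (auto simp: others_def)
  have lk: "links n = (\<lambda>j. (j, i)) ` others \<union> unseen" "(\<lambda>j. (j, i)) ` others \<inter> unseen = {}"
    "inj_on (\<lambda>j. (j, i)) others"
    using i_agent by (auto simp: links_def unseen_def others_def inj_on_def)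
  have prod_links: "prod g (links n) = (\<Prod>j\<in>others. g (j, i)) * prod g unseen" for g :: "nat \<times> nat \<Rightarrow> real"
    unfolding lk(1) using lk(2,3) by (subst prod.union_disjoint) (auto simp: prod.reindex)
  have snd_unseen: "snd p \<noteq> i" if "p \<in> unseen" for p
    using that by (auto simp: unseen_def)
  have nd: "normal_density \<mu> s x = c s * exp (- ((x - \<mu>)\<^sup>2 / (2 * s\<^sup>2)))" for \<mu> s x
    by (simp add: normal_density_def c_def)
  have "slice_density n \<sigma> \<tau> i v (\<theta>, x, y) = C * exp (- energy v (\<theta>, x, y))" for v \<theta> x y
  proof -
    have "slice_density n \<sigma> \<tau> i v (\<theta>, x, y) =
      (normal_density \<theta> \<sigma> (v i) * (\<Prod>j\<in>others. normal_density \<theta> \<sigma> ((x(i := v i)) j))) *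
      ((\<Prod>j\<in>others. normal_density ((x(i := v i)) j) \<tau> (v j)) *
       (\<Prod>p\<in>unseen. normal_density (signals v x (fst p)) \<tau> (y p)))"
      unfolding slice_density_def joint_density_def prod.case prod_links agents(1)
      using agents(2)
      by (intro arg_cong2[of _ _ _ _ "(*)"] prod.cong)
        (auto simp: signals_def split_beta snd_unseen intro!: arg_cong2[of _ _ _ _ "(*)"])
    also have "\<dots> = (normal_density \<theta> \<sigma> (v i) * (\<Prod>j\<in>others. normal_density \<theta> \<sigma> (x j))) *
      ((\<Prod>j\<in>others. normal_density (x j) \<tau> (v j)) *
       (\<Prod>p\<in>unseen. normal_density (signals v x (fst p)) \<tau> (y p)))"
      using agents(2) by (intro arg_cong2[of _ _ _ _ "(*)"] prod.cong refl) auto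
    also have "\<dots> = C * (exp (- ((v i - \<theta>)\<^sup>2 / (2 * \<sigma>\<^sup>2))) * exp (- (\<Sum>j\<in>others. (x j - \<theta>)\<^sup>2 / (2 * \<sigma>\<^sup>2)))
       * (exp (- (\<Sum>j\<in>others. (v j - x j)\<^sup>2 / (2 * \<tau>\<^sup>2)))
       * exp (- (\<Sum>p\<in>unseen. (y p - signals v x (fst p))\<^sup>2 / (2 * \<tau>\<^sup>2)))))"
      unfolding nd C_def by (simp add: prod.distrib exp_sum[symmetric] sum_negf)
    also have "\<dots> = C * exp (- energy v (\<theta>, x, y))"
      by (simp add: exp_add[symmetric] sum_divide_distrib[symmetric] add_divide_distrib)
    finally show ?thesis .
  qed
  moreover have "C > 0"
    using \<sigma>_pos \<tau>_pos by (simp add: C_def c_def)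
  ultimately show ?thesis
    by (intro exI[of _ C]) auto
qed

lemma sigma_finite_PiM_lborel: "finite A \<Longrightarrow> sigma_finite_measure (\<Pi>\<^sub>M j\<in>A. (lborel :: real measure))"
proof -
  assume "finite A"
  then interpret finite_product_sigma_finite "\<lambda>_. lborel :: real measure" A by unfold_locales
  show ?thesis by unfold_locales
qed

lemma sigma_finite_unobserved_snd:
  "sigma_finite_measure ((\<Pi>\<^sub>M j\<in>others. (lborel :: real measure)) \<Otimes>\<^sub>M (\<Pi>\<^sub>M p\<in>unseen. (lborel :: real measure)))"
  by (intro sigma_finite_pair_measure sigma_finite_PiM_lborel) auto

lemma measurable_theta: "fst \<in> borel_measurable (unobserved n i)"
  unfolding unobserved_eq by measurable

lemma measurable_signal: "(\<lambda>s. fst (snd s) j) \<in> borel_measurable (unobserved n i)" if "j \<in> others"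
  unfolding unobserved_eq by (measurable; use that in simp)

lemma measurable_link: "(\<lambda>s. snd (snd s) p) \<in> borel_measurable (unobserved n i)" if "p \<in> unseen"
  unfolding unobserved_eq by (measurable; use that in simp)

lemma measurable_signals:
  "(\<lambda>s. signals v (fst (snd s)) (fst p)) \<in> borel_measurable (unobserved n i)" if "p \<in> unseen"
proof (cases "fst p = i")
  case False
  then have "fst p \<in> others" using that by (auto simp: unseen_def links_def others_def)
  then show ?thesis using False by (simp add: signals_def measurable_signal)
qed (simp add: signals_def)

lemmas measurable_components = measurable_theta measurable_signal measurable_link measurable_signals

lemma measurable_slice_density [measurable]: "slice_density n \<sigma> \<tau> i v \<in> borel_measurable (unobserved n i)"
proof -
  obtain C where "C > 0" and C: "\<And>v s. slice_density n \<sigma> \<tau> i v s = C * exp (- energy v s)"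
    using slice_density_eq_exp by blast
  have "energy v = (\<lambda>s. ((v i - fst s)\<^sup>2 + (\<Sum>j\<in>others. (fst (snd s) j - fst s)\<^sup>2)) / (2 * \<sigma>\<^sup>2) +
     ((\<Sum>j\<in>others. (v j - fst (snd s) j)\<^sup>2)
       + (\<Sum>p\<in>unseen. (snd (snd s) p - signals v (fst (snd s)) (fst p))\<^sup>2)) / (2 * \<tau>\<^sup>2))"
    by (auto simp: fun_eq_iff)
  also have "\<dots> \<in> borel_measurable (unobserved n i)"
    by (intro borel_measurable_add borel_measurable_divide borel_measurable_sum borel_measurable_power
        borel_measurable_diff borel_measurable_const measurable_components)
  finally have [measurable]: "energy v \<in> borel_measurable (unobserved n i)" .
  have "slice_density n \<sigma> \<tau> i v = (\<lambda>s. C * exp (- energy v s))"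
    by (rule ext) (rule C)
  then show ?thesis by simp
qed

lemma slice_density_pos: "slice_density n \<sigma> \<tau> i v s > 0"
proof -
  obtain C where "C > 0" and C: "\<And>v s. slice_density n \<sigma> \<tau> i v s = C * exp (- energy v s)"
    using slice_density_eq_exp by blast
  then show ?thesis by simp
qed

text \<open>One family for both symmetries: \<open>p = id\<close> gives translations, zero shifts
  give relabellings of the other agents, acting on both ends of a link.\<close>

definition affine_map where
  "affine_map p c d e = (\<lambda>(\<theta>::real, x::nat \<Rightarrow> real, y::nat \<times> nat \<Rightarrow> real).
     (\<theta> + c, \<lambda>j\<in>others. x (p j) + d j, \<lambda>q\<in>unseen. y (map_prod p p q) + e q))"

lemma affine_map:
  assumes p: "p permutes others"
  shows measurable_affine_map: "affine_map p c d e \<in> unobserved n i \<rightarrow>\<^sub>M unobserved n i"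
    and distr_affine_map: "distr (unobserved n i) (unobserved n i) (affine_map p c d e) = unobserved n i"
    and bij_betw_unseen: "bij_betw (map_prod p p) unseen unseen"
proof -
  have pi: "p i = i" using p by (simp add: others_def permutes_not_in)
  have pa: "p j \<in> {1..n}" "p j \<noteq> i \<longleftrightarrow> j \<noteq> i" if "j \<in> {1..n}" for j
    using permutes_in_image[OF p, of j] that pi i_agent by (auto simp: others_def)
  have inj: "inj p" using p by (rule permutes_inj)
  have "map_prod p p ` unseen \<subseteq> unseen"
    using pa inj by (auto simp: unseen_def links_def inj_eq)
  moreover have inj2: "inj_on (map_prod p p) unseen"
    using prod.inj_map[OF inj inj] by (rule inj_on_subset) simp
  ultimately show bij: "bij_betw (map_prod p p) unseen unseen"
    by (simp add: bij_betw_def endo_inj_surj)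
  have bijp: "bij_betw p others others" using p by (rule permutes_imp_bij)
  note m1 = measurable_PiM_lborel_reindex[OF bijp, of d] and m2 = measurable_PiM_lborel_reindex[OF bij, of e]
  have eq: "affine_map p c d e = (\<lambda>(\<theta>, s). (c + \<theta>, (\<lambda>(x, y). (\<lambda>j\<in>others. x (p j) + d j, \<lambda>q\<in>unseen. y (map_prod p p q) + e q)) s))"
    by (auto simp: affine_map_def fun_eq_iff)
  have m12: "(\<lambda>(x, y). (\<lambda>j\<in>others. x (p j) + d j, \<lambda>q\<in>unseen. y (map_prod p p q) + e q))
      \<in> (\<Pi>\<^sub>M j\<in>others. lborel) \<Otimes>\<^sub>M (\<Pi>\<^sub>M p\<in>unseen. lborel) \<rightarrow>\<^sub>M (\<Pi>\<^sub>M j\<in>others. lborel) \<Otimes>\<^sub>M (\<Pi>\<^sub>M p\<in>unseen. lborel)"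
    using measurable_Pair[OF measurable_compose[OF measurable_fst m1] measurable_compose[OF measurable_snd m2]]
    by (simp add: split_beta')
  show "affine_map p c d e \<in> unobserved n i \<rightarrow>\<^sub>M unobserved n i"
  proof -
    have "(\<lambda>s. c + fst s) \<in> unobserved n i \<rightarrow>\<^sub>M lborel"
      using measurable_theta by simp
    from measurable_Pair[OF this[unfolded unobserved_eq] measurable_compose[OF measurable_snd m12]]
    show ?thesis
      unfolding eq unobserved_eq by (simp add: split_beta')
  qed
  have d1: "distr (\<Pi>\<^sub>M j\<in>others. lborel) (\<Pi>\<^sub>M j\<in>others. lborel) (\<lambda>x. \<lambda>j\<in>others. x (p j) + d j) = (\<Pi>\<^sub>M j\<in>others. lborel)"
    using bijp by (rule distr_PiM_lborel_reindex[rotated]) simp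
  have d2: "distr (\<Pi>\<^sub>M j\<in>unseen. lborel) (\<Pi>\<^sub>M j\<in>unseen. lborel) (\<lambda>x. \<lambda>q\<in>unseen. x (map_prod p p q) + e q) = (\<Pi>\<^sub>M j\<in>unseen. lborel)"
    using bij by (rule distr_PiM_lborel_reindex[rotated]) simp
  have d12: "distr ((\<Pi>\<^sub>M j\<in>others. lborel) \<Otimes>\<^sub>M (\<Pi>\<^sub>M p\<in>unseen. lborel)) ((\<Pi>\<^sub>M j\<in>others. lborel) \<Otimes>\<^sub>M (\<Pi>\<^sub>M p\<in>unseen. lborel))
      (\<lambda>(x, y). (\<lambda>j\<in>others. x (p j) + d j, \<lambda>q\<in>unseen. y (map_prod p p q) + e q))
     = (\<Pi>\<^sub>M j\<in>others. lborel) \<Otimes>\<^sub>M (\<Pi>\<^sub>M p\<in>unseen. lborel)"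
    using pair_measure_distr[OF m1 m2] by (simp add: d1 d2 sigma_finite_PiM_lborel)
  have d0: "distr lborel lborel ((+) c) = lborel"
    using lborel_distr_plus[of c] by (simp cong: distr_cong)
  show "distr (unobserved n i) (unobserved n i) (affine_map p c d e) = unobserved n i"
    unfolding eq unobserved_eq
    using pair_measure_distr[of "(+) c" lborel lborel, OF _ m12] by (simp add: d0 d12 sigma_finite_unobserved_snd)
qed

text \<open>The substitution preserves Lebesgue measure and turns the slice at \<open>v\<close> into
  \<open>K\<close> times the slice at \<open>v'\<close>. The normalising integral acquires the same
  factor, so \<open>K\<close> cancels.\<close>

lemma integral_posterior_affine:
  assumes p: "p permutes others" and f: "f \<in> borel_measurable (unobserved n i)" and "K > 0"
    and s: "\<And>s. slice_density n \<sigma> \<tau> i v (affine_map p c d e s) = K * slice_density n \<sigma> \<tau> i v' s"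
  shows "(LINT s|posterior n \<sigma> \<tau> i v. f s) = (LINT s|posterior n \<sigma> \<tau> i v'. f (affine_map p c d e s) :: real)"
proof -
  let ?N = "unobserved n i" and ?F = "affine_map p c d e"
  note [measurable] = f measurable_affine_map[OF p, of c d e]
  have nn: "slice_density n \<sigma> \<tau> i v s \<ge> 0" for v s
    using slice_density_pos by (rule less_imp_le)
  define Z where "Z v = (LINT s|?N. slice_density n \<sigma> \<tau> i v s)" for v
  have Znn: "Z v \<ge> 0" for v unfolding Z_def using nn by (rule Bochner_Integration.integral_nonneg)
  have transf: "(LINT s|?N. h s) = (LINT s|?N. h (?F s))" if [measurable]: "h \<in> borel_measurable ?N" for h :: "state \<Rightarrow> real"
    by (subst (1) distr_affine_map[OF p, of c d e, symmetric], subst integral_distr) auto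
  have post: "(LINT s|posterior n \<sigma> \<tau> i v. g s) = (LINT s|?N. slice_density n \<sigma> \<tau> i v s / Z v * g s)"
    if [measurable]: "g \<in> borel_measurable ?N" for v and g :: "state \<Rightarrow> real"
    unfolding posterior_def Z_def[symmetric] using nn Znn by (subst integral_density) auto
  have "Z v = K * Z v'"
    using transf[of "slice_density n \<sigma> \<tau> i v"] by (simp add: Z_def s)
  have "(LINT s|posterior n \<sigma> \<tau> i v. f s) = (LINT s|?N. slice_density n \<sigma> \<tau> i v s / Z v * f s)"
    by (rule post) measurable
  also have "\<dots> = (LINT s|?N. slice_density n \<sigma> \<tau> i v (?F s) / Z v * f (?F s))"
    by (rule transf) measurable
  also have "\<dots> = (LINT s|?N. slice_density n \<sigma> \<tau> i v' s / Z v' * f (?F s))"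
    using \<open>K > 0\<close> by (simp add: s \<open>Z v = K * Z v'\<close>)
  also have "\<dots> = (LINT s|posterior n \<sigma> \<tau> i v'. f (?F s))"
    by (rule post[symmetric]) measurable
  finally show ?thesis .
qed

end

section \<open>Coercivity of the energy and moments at the zero observation\<close>

lemma integrable_exp_minus_square:
  assumes "c > 0"
  shows "integrable lborel (\<lambda>x::real. exp (- c * x\<^sup>2))"
proof -
  let ?s = "1 / sqrt (2 * c)"
  have "integrable lborel (\<lambda>x. sqrt (2 * pi * ?s\<^sup>2) * normal_density 0 ?s x)"
    using assms by (intro integrable_mult_right integrable_normal_density) simp
  also have "(\<lambda>x. sqrt (2 * pi * ?s\<^sup>2) * normal_density 0 ?s x) = (\<lambda>x. exp (- c * x\<^sup>2))"
    using assms by (auto simp: normal_density_def fun_eq_iff power_divide field_simps)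
  finally show ?thesis .
qed

context observer
begin

fun sq_norm :: "state \<Rightarrow> real" where
  "sq_norm (\<theta>, x, y) = \<theta>\<^sup>2 + (\<Sum>j\<in>others. (x j)\<^sup>2) + (\<Sum>p\<in>unseen. (y p)\<^sup>2)"

lemma sq_norm_nonneg: "sq_norm s \<ge> 0"
  by (cases s) (auto intro!: add_nonneg_nonneg sum_nonneg)

text \<open>At the zero observation \<open>\<theta>\<close> and the \<open>x j\<close> have their
  own squares in the energy, while \<open>y p\<close> occurs only as a difference to a signal. Its
  square is at most twice the squared difference plus twice the squared signal, and each squared
  signal is at most the sum over all of them.\<close>

lemma energy_0_ge_sq_norm:
  obtains c where "c > 0" "\<And>s. energy (\<lambda>_. 0) s \<ge> c * sq_norm s"
proof -
  \<comment> \<open>\<open>\<delta>\<close> inverts the factor in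
    \<open>S + Y \<le> (2 + 2 * card unseen) * (S + W)\<close>, where \<open>S\<close>,
    \<open>Y\<close>, \<open>W\<close> are the sums of squares of signals, links and link noises;
    \<open>c\<close> is the smaller of the rates for \<open>\<theta>\<close> and for the
    rest.\<close>
  define \<delta> where "\<delta> = 1 / (2 + 2 * real (card unseen))"
  define c where "c = min (1 / (2 * \<sigma>\<^sup>2)) (\<delta> / (2 * \<tau>\<^sup>2))"
  have "energy (\<lambda>_. 0) (\<theta>, x, y) \<ge> c * sq_norm (\<theta>, x, y)" for \<theta> x y
  proof -
    let ?X = "signals (\<lambda>_. 0) x"
    define S where "S = (\<Sum>j\<in>others. (x j)\<^sup>2)"
    define Y where "Y = (\<Sum>p\<in>unseen. (y p)\<^sup>2)"
    define W where "W = (\<Sum>p\<in>unseen. (y p - ?X (fst p))\<^sup>2)"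
    have pos: "S \<ge> 0" "Y \<ge> 0" "W \<ge> 0"
      by (auto simp: S_def Y_def W_def intro: sum_nonneg)
    have X: "(?X (fst p))\<^sup>2 \<le> S" if "p \<in> unseen" for p
    proof (cases "fst p = i")
      case False
      then have "fst p \<in> others" using that by (auto simp: unseen_def links_def others_def)
      then show ?thesis using False by (auto simp: signals_def S_def intro: member_le_sum)
    qed (use pos in \<open>simp add: signals_def\<close>)
    have "Y \<le> (\<Sum>p\<in>unseen. 2 * (y p - ?X (fst p))\<^sup>2 + 2 * S)"
      unfolding Y_def
    proof (rule sum_mono)
      fix p assume p: "p \<in> unseen"
      have "0 \<le> (y p - 2 * ?X (fst p))\<^sup>2" by simp
      then have "(y p)\<^sup>2 \<le> 2 * (y p - ?X (fst p))\<^sup>2 + 2 * (?X (fst p))\<^sup>2"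
        by (simp add: power2_eq_square algebra_simps)
      then show "(y p)\<^sup>2 \<le> 2 * (y p - ?X (fst p))\<^sup>2 + 2 * S"
        using X[OF p] by simp
    qed
    also have "\<dots> = 2 * W + 2 * real (card unseen) * S"
      by (simp add: W_def sum.distrib sum_distrib_left)
    finally have "Y \<le> 2 * W + 2 * real (card unseen) * S" .
    then have "S + Y \<le> (2 + 2 * real (card unseen)) * (S + W)"
    proof -
      assume "Y \<le> 2 * W + 2 * real (card unseen) * S"
      moreover have "0 \<le> real (card unseen) * W" using pos by simp
      moreover have "(2 + 2 * real (card unseen)) * (S + W)
          = 2 * S + 2 * W + 2 * real (card unseen) * S + 2 * (real (card unseen) * W)"
        by (simp add: algebra_simps)
      ultimately show ?thesis using pos by linarith
    qed
    then have "\<delta> * (S + Y) \<le> S + W"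
      by (simp add: \<delta>_def divide_le_eq mult.commute)
    then have "\<delta> / (2 * \<tau>\<^sup>2) * (S + Y) \<le> (S + W) / (2 * \<tau>\<^sup>2)"
      using \<tau>_pos by (simp add: divide_right_mono)
    moreover have "c * (S + Y) \<le> \<delta> / (2 * \<tau>\<^sup>2) * (S + Y)"
      using pos by (intro mult_right_mono) (auto simp: c_def)
    moreover have "c * \<theta>\<^sup>2 \<le> 1 / (2 * \<sigma>\<^sup>2) * \<theta>\<^sup>2"
      by (intro mult_right_mono) (auto simp: c_def)
    moreover have "\<theta>\<^sup>2 / (2 * \<sigma>\<^sup>2) \<le> (\<theta>\<^sup>2 + (\<Sum>j\<in>others. (x j - \<theta>)\<^sup>2)) / (2 * \<sigma>\<^sup>2)"
      using \<sigma>_pos by (intro divide_right_mono) (auto intro: sum_nonneg)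
    ultimately show ?thesis
      by (simp add: S_def[symmetric] Y_def[symmetric] W_def[symmetric] algebra_simps)
  qed
  moreover have "c > 0"
    using \<sigma>_pos \<tau>_pos by (simp add: c_def \<delta>_def)
  ultimately show ?thesis
    by (intro that[of c]) auto
qed

lemma integrable_exp_sq_norm:
  assumes c: "c > 0"
  shows "integrable (unobserved n i) (\<lambda>s. exp (- c * sq_norm s))"
proof -
  interpret L1: product_sigma_finite "\<lambda>_::nat. lborel :: real measure" ..
  interpret L2: product_sigma_finite "\<lambda>_::nat \<times> nat. lborel :: real measure" ..
  note I = integrable_exp_minus_square[OF c]
  have 1: "integrable (\<Pi>\<^sub>M j\<in>others. lborel) (\<lambda>x. \<Prod>j\<in>others. exp (- c * (x j)\<^sup>2))"
    by (rule L1.product_integrable_prod[OF _ I]) simp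
  have 2: "integrable (\<Pi>\<^sub>M j\<in>unseen. lborel) (\<lambda>x. \<Prod>j\<in>unseen. exp (- c * (x j)\<^sup>2))"
    by (rule L2.product_integrable_prod[OF _ I]) simp
  note 12 = integrable_pair_mult[OF sigma_finite_PiM_lborel sigma_finite_PiM_lborel 1 2]
  note 3 = integrable_pair_mult[OF sigma_finite_lborel sigma_finite_unobserved_snd I 12]
  have eq: "(\<lambda>(\<theta>, s). exp (- c * \<theta>\<^sup>2) * (\<lambda>(x, y). (\<Prod>j\<in>others. exp (- c * (x j)\<^sup>2)) * (\<Prod>j\<in>unseen. exp (- c * (y j)\<^sup>2))) s)
      = (\<lambda>s. exp (- c * sq_norm s))"
    by (auto simp: fun_eq_iff exp_sum[symmetric] exp_add[symmetric] sum_negf sum_distrib_left distrib_left)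
  show ?thesis
    using 3 unfolding unobserved_eq eq by simp
qed

text \<open>Half of the Gaussian decay is spent on the quadratic factor, since
  \<open>R * exp (- (c / 2) * R)\<close> stays below \<open>2 / c\<close>; the other half is
  integrable. Quadratic growth is what covariances require.\<close>

lemma integrable_mult_slice_density_0:
  assumes f[measurable]: "f \<in> borel_measurable (unobserved n i)"
    and bound: "\<And>s. \<bar>f s\<bar> \<le> K * (1 + sq_norm s)"
  shows "integrable (unobserved n i) (\<lambda>s. slice_density n \<sigma> \<tau> i (\<lambda>_. 0) s * f s :: real)"
proof -
  obtain C where C: "C > 0" "\<And>v s. slice_density n \<sigma> \<tau> i v s = C * exp (- energy v s)"
    using slice_density_eq_exp by blast
  obtain c where c: "c > 0" "\<And>s. energy (\<lambda>_. 0) s \<ge> c * sq_norm s"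
    by (rule energy_0_ge_sq_norm) blast
  \<comment> \<open>Nonnegativity of \<open>K\<close> is read off from the bound at one arbitrary
    state.\<close>
  have "0 \<le> \<bar>f undefined\<bar>" by simp
  also have "\<dots> \<le> K * (1 + sq_norm undefined)" by (rule bound)
  finally have K: "K \<ge> 0"
    using sq_norm_nonneg[of undefined] by (simp add: zero_le_mult_iff)
  have "integrable (unobserved n i) (\<lambda>s. C * K * (1 + 2 / c) * exp (- (c / 2) * sq_norm s))"
    using c by (intro integrable_mult_right integrable_exp_sq_norm) simp
  then show ?thesis
  proof (rule Bochner_Integration.integrable_bound)
    show "AE s in unobserved n i. norm (slice_density n \<sigma> \<tau> i (\<lambda>_. 0) s * f s)
        \<le> norm (C * K * (1 + 2 / c) * exp (- (c / 2) * sq_norm s))"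
    proof (rule AE_I2)
      fix s
      define R where "R = sq_norm s"
      have R: "R \<ge> 0" by (simp add: R_def sq_norm_nonneg)
      have "c / 2 * R \<le> exp (c / 2 * R)" using exp_ge_add_one_self[of "c / 2 * R"] by linarith
      then have "c / 2 * R * exp (- (c / 2) * R) \<le> exp (c / 2 * R) * exp (- (c / 2) * R)"
        by (intro mult_right_mono) auto
      then have *: "R * exp (- (c / 2) * R) \<le> 2 / c"
      proof -
        assume *: "c / 2 * R * exp (- (c / 2) * R) \<le> exp (c / 2 * R) * exp (- (c / 2) * R)"
        have "exp (c / 2 * R) * exp (- (c / 2) * R) = 1" by (simp flip: exp_add)
        with * have "c / 2 * R * exp (- (c / 2) * R) \<le> 1" by linarith
        moreover have "R * exp (- (c / 2) * R) * c = 2 * (c / 2 * R * exp (- (c / 2) * R))" by simp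
        ultimately show ?thesis using c(1) by (simp only: pos_le_divide_eq)
      qed
      have e1: "exp (- (c / 2) * R) \<le> 1" using c R by simp
      have "exp (- energy (\<lambda>_. 0) s) * \<bar>f s\<bar> \<le> exp (- (c * R)) * (K * (1 + R))"
        using c(2)[of s] bound[of s] by (intro mult_mono) (auto simp: R_def)
      also have "\<dots> = K * ((exp (- (c / 2) * R) + R * exp (- (c / 2) * R)) * exp (- (c / 2) * R))"
        by (simp add: algebra_simps exp_add[symmetric])
      also have "\<dots> \<le> K * ((1 + 2 / c) * exp (- (c / 2) * R))"
        using * e1 K by (intro mult_left_mono mult_right_mono add_mono) auto
      finally have "C * (exp (- energy (\<lambda>_. 0) s) * \<bar>f s\<bar>) \<le> C * (K * ((1 + 2 / c) * exp (- (c / 2) * R)))"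
        using C(1) by (intro mult_left_mono) auto
      then show "norm (slice_density n \<sigma> \<tau> i (\<lambda>_. 0) s * f s)
          \<le> norm (C * K * (1 + 2 / c) * exp (- (c / 2) * sq_norm s))"
        using C c(1) K by (simp add: abs_mult R_def mult.assoc)
    qed
  qed measurable
qed

abbreviation "P0 \<equiv> posterior n \<sigma> \<tau> i (\<lambda>_. 0)"

text \<open>Integrability against a posterior is established at the zero observation only; every
  other posterior is reached from it by translation.\<close>

lemma P0_facts:
  shows prob_space_P0: "prob_space P0"
    and integrable_P0: "\<And>f K. f \<in> borel_measurable (unobserved n i) \<Longrightarrow> (\<And>s. \<bar>f s\<bar> \<le> K * (1 + sq_norm s))
      \<Longrightarrow> integrable P0 (f :: _ \<Rightarrow> real)"
proof -
  let ?N = "unobserved n i" and ?g = "slice_density n \<sigma> \<tau> i (\<lambda>_. 0)"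
  define Z where "Z = (LINT s|?N. ?g s)"
  have g: "?g s > 0" for s by (rule slice_density_pos)
  have I: "integrable ?N ?g"
    using integrable_mult_slice_density_0[of "\<lambda>_. 1" 1] sq_norm_nonneg by simp
  have nn0: "AE s in ?N. 0 \<le> ?g s"
    by (intro AE_I2 less_imp_le g)
  \<comment> \<open>A vanishing integral of a strictly positive density would make
    \<open>unobserved n i\<close> a null measure, but each of its Lebesgue factors has nonzero
    mass.\<close>
  have "Z \<noteq> 0"
  proof
    assume "Z = 0"
    then have "AE s in ?N. ?g s = 0"
      unfolding Z_def by (subst (asm) integral_nonneg_eq_0_iff_AE[OF I nn0])
    then have "AE s in ?N. False"
      by eventually_elim (use g in \<open>auto simp: less_le\<close>)
    then have "emeasure ?N (space ?N) = 0"
      by (simp add: AE_iff_measurable[of "space ?N"])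
    moreover have PiM_inf: "emeasure (\<Pi>\<^sub>M j\<in>A. lborel) (space (\<Pi>\<^sub>M j\<in>A. (lborel :: real measure))) \<noteq> 0"
      if "finite A" for A :: "'a set"
    proof -
      interpret product_sigma_finite "\<lambda>_::'a. lborel :: real measure" ..
      show ?thesis
        using that by (simp add: space_PiM emeasure_PiM)
    qed
    interpret S1: sigma_finite_measure "\<Pi>\<^sub>M p\<in>unseen. (lborel :: real measure)"
      by (rule sigma_finite_PiM_lborel) simp
    interpret S2: sigma_finite_measure "(\<Pi>\<^sub>M j\<in>others. (lborel :: real measure)) \<Otimes>\<^sub>M (\<Pi>\<^sub>M p\<in>unseen. (lborel :: real measure))"
      by (rule sigma_finite_unobserved_snd)
    have "emeasure ?N (space ?N) \<noteq> 0"
      unfolding unobserved_eq space_pair_measure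
      by (subst S2.emeasure_pair_measure_Times; (simp add: space_pair_measure[symmetric])?)
        (simp add: space_pair_measure S1.emeasure_pair_measure_Times PiM_inf)
    ultimately show False by simp
  qed
  moreover have "Z \<ge> 0"
    unfolding Z_def using g by (intro Bochner_Integration.integral_nonneg) (auto intro: less_imp_le)
  ultimately have Z: "Z > 0" by simp
  have P: "P0 = density ?N (\<lambda>s. ennreal (?g s / Z))"
    by (simp add: posterior_def Z_def)
  show "prob_space P0"
  proof
    have "emeasure P0 (space P0) = (\<integral>\<^sup>+s. ennreal (?g s / Z) \<partial>?N)"
      unfolding P by (simp add: emeasure_density cong: nn_integral_cong)
    also have "\<dots> = ennreal (LINT s|?N. ?g s / Z)"
      using I Z nn0 by (intro nn_integral_eq_integral) auto
    also have "\<dots> = 1" using Z by (simp add: Z_def)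
    finally show "emeasure P0 (space P0) = 1" .
  qed
  fix f :: "_ \<Rightarrow> real" and K
  assume f[measurable]: "f \<in> borel_measurable ?N" and b: "\<And>s. \<bar>f s\<bar> \<le> K * (1 + sq_norm s)"
  have "integrable ?N (\<lambda>s. (?g s * f s) / Z)"
    using integrable_mult_slice_density_0[OF f b] by simp
  then show "integrable P0 f"
  proof -
    have nn: "AE s in ?N. 0 \<le> ?g s / Z"
      using g Z by (intro AE_I2 divide_nonneg_pos less_imp_le)
    assume "integrable ?N (\<lambda>s. (?g s * f s) / Z)"
    then show ?thesis
      unfolding P by (subst integrable_density[OF _ _ nn]) auto
  qed
qed

section \<open>Conditional covariances under translation and relabelling\<close>

lemma energy_translate:
  obtains c d e K where "\<And>s. energy v (affine_map id c d e s) = energy (\<lambda>_. 0) s + K"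
    "\<And>p. p \<in> unseen \<Longrightarrow> fst p \<noteq> i \<Longrightarrow> e p = d (fst p)"
proof -
  text \<open>The shift is the minimiser of the energy, i.e. the posterior mean.\<close>
  define w where "w = \<tau>\<^sup>2 / (\<sigma>\<^sup>2 + \<tau>\<^sup>2)"
  define t where "t = (v i + (1 - w) * (\<Sum>j\<in>others. v j)) / (1 + (1 - w) * card others)"
  define d where "d j = w * t + (1 - w) * v j" for j
  \<comment> \<open>A link out of the observer is centered at the known \<open>v i\<close> instead
    of an entry of \<open>d\<close>; hence the restriction to \<open>fst p \<noteq> i\<close> in the
    second conclusion.\<close>
  define e where "e p = signals v d (fst p)" for p :: "nat \<times> nat"
  define K where "K = ((v i - t)\<^sup>2 + (\<Sum>j\<in>others. (d j - t)\<^sup>2)) / (2 * \<sigma>\<^sup>2) + (\<Sum>j\<in>others. (v j - d j)\<^sup>2) / (2 * \<tau>\<^sup>2)"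
  have st: "\<sigma>\<^sup>2 > 0" "\<tau>\<^sup>2 > 0" "\<sigma>\<^sup>2 + \<tau>\<^sup>2 > 0" using \<sigma>_pos \<tau>_pos by (auto intro: add_pos_pos)
  have w: "0 < w" "w < 1" using st by (auto simp: w_def)
  have "1 + (1 - w) * card others > 0" using w by (intro add_pos_nonneg) auto
  then have "t * (1 + (1 - w) * card others) = v i + (1 - w) * (\<Sum>j\<in>others. v j)"
    by (simp add: t_def)
  moreover have "(\<Sum>j\<in>others. d j - t) = (1 - w) * (\<Sum>j\<in>others. v j) - (1 - w) * t * card others"
    by (simp add: d_def sum_subtractf sum.distrib sum_distrib_left algebra_simps)
  \<comment> \<open>The stationarity conditions, here for \<open>\<theta>\<close> and next for each
    \<open>x j\<close>, remove the terms of the shifted energy that are linear in the state.\<close>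
  ultimately have crit_t: "(v i - t) + (\<Sum>j\<in>others. d j - t) = 0"
    by (simp add: algebra_simps)
  have crit_d: "(d j - t) / \<sigma>\<^sup>2 = (v j - d j) / \<tau>\<^sup>2" for j
  proof -
    have "1 - w = \<sigma>\<^sup>2 / (\<sigma>\<^sup>2 + \<tau>\<^sup>2)" using st by (simp add: w_def field_simps)
    moreover have "d j - t = (1 - w) * (v j - t)" "v j - d j = w * (v j - t)"
      by (simp_all add: d_def algebra_simps)
    ultimately show ?thesis using st by (simp add: w_def)
  qed
  have "energy v (affine_map id t d e (\<theta>, x, y)) = energy (\<lambda>_. 0) (\<theta>, x, y) + K" for \<theta> x y
  proof -
    have y: "(y p + e p - signals v (\<lambda>j\<in>others. x j + d j) (fst p))\<^sup>2 = (y p - signals (\<lambda>_. 0) x (fst p))\<^sup>2"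
      if "p \<in> unseen" for p
      using that by (auto simp: e_def signals_def unseen_def links_def others_def)
    have 1: "(v i - (\<theta> + t))\<^sup>2 = \<theta>\<^sup>2 - 2 * \<theta> * (v i - t) + (v i - t)\<^sup>2"
      by (simp add: power2_eq_square algebra_simps)
    have 2: "(\<Sum>j\<in>others. (x j + d j - (\<theta> + t))\<^sup>2)
        = (\<Sum>j\<in>others. (x j - \<theta>)\<^sup>2) + 2 * (\<Sum>j\<in>others. x j * (d j - t)) - 2 * \<theta> * (\<Sum>j\<in>others. d j - t)
          + (\<Sum>j\<in>others. (d j - t)\<^sup>2)"
      unfolding sum_distrib_left sum.distrib[symmetric] sum_subtractf[symmetric]
      by (rule sum.cong) (auto simp: power2_eq_square algebra_simps)
    have 3: "(\<Sum>j\<in>others. (v j - (x j + d j))\<^sup>2)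
        = (\<Sum>j\<in>others. (x j)\<^sup>2) - 2 * (\<Sum>j\<in>others. x j * (v j - d j)) + (\<Sum>j\<in>others. (v j - d j)\<^sup>2)"
      unfolding sum_distrib_left sum.distrib[symmetric] sum_subtractf[symmetric]
      by (rule sum.cong) (auto simp: power2_eq_square algebra_simps)
    have 4: "(\<Sum>j\<in>others. x j * (d j - t)) / \<sigma>\<^sup>2 = (\<Sum>j\<in>others. x j * (v j - d j)) / \<tau>\<^sup>2"
      unfolding sum_divide_distrib by (rule sum.cong) (use crit_d in \<open>auto simp flip: times_divide_eq_right\<close>)
    have 5: "(\<Sum>j\<in>others. d j - t) = - (v i - t)" using crit_t by simp
    have "energy v (affine_map id t d e (\<theta>, x, y)) =
       ((v i - (\<theta> + t))\<^sup>2 + (\<Sum>j\<in>others. (x j + d j - (\<theta> + t))\<^sup>2)) / (2 * \<sigma>\<^sup>2) +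
       ((\<Sum>j\<in>others. (v j - (x j + d j))\<^sup>2) + (\<Sum>p\<in>unseen. (y p - signals (\<lambda>_. 0) x (fst p))\<^sup>2)) / (2 * \<tau>\<^sup>2)"
      by (simp add: affine_map_def prod.map_id0 y cong: sum.cong)
    also have "\<dots> = energy (\<lambda>_. 0) (\<theta>, x, y) + K
        + ((\<Sum>j\<in>others. x j * (d j - t)) / \<sigma>\<^sup>2 - (\<Sum>j\<in>others. x j * (v j - d j)) / \<tau>\<^sup>2)"
    proof -
      have aux: "(\<theta>\<^sup>2 - 2 * \<theta> * u + b + (A + 2 * B - 2 * \<theta> * (- u) + D)) / (2 * s) + (E - 2 * F + G + H) / (2 * r)
        = (\<theta>\<^sup>2 + A) / (2 * s) + (E + H) / (2 * r) + ((b + D) / (2 * s) + G / (2 * r)) + (B / s - F / r)"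
        if "s > 0" "r > 0" for u b A B D E F G H s r :: real
        using that by (simp add: field_simps)
      show ?thesis
        unfolding 1 2 3 5 K_def by (subst aux) (use st in simp_all)
    qed
    finally show ?thesis using 4 by simp
  qed
  then show ?thesis
    by (intro that[of t d e K]) (auto simp: e_def signals_def)
qed

lemma observation_simps:
  "observation l s j = (if j = l then fst (snd s) l else snd (snd s) (j, l))"
  by (cases s) auto

lemma observation_facts:
  assumes l: "l \<in> others" and j: "j \<in> others"
  shows measurable_observation: "(\<lambda>s. observation l s j) \<in> borel_measurable (unobserved n i)"
    and observation_sq_le: "(observation l s j)\<^sup>2 \<le> sq_norm s"
proof -
  have u: "(j, l) \<in> unseen" if "j \<noteq> l"
    using that l j by (auto simp: unseen_def links_def others_def)
  show "(\<lambda>s. observation l s j) \<in> borel_measurable (unobserved n i)"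
    unfolding observation_simps using u measurable_link measurable_signal[OF l] by (cases "j = l") auto
  obtain \<theta> x y where s: "s = (\<theta>, x, y)" by (cases s)
  have "(x l)\<^sup>2 \<le> (\<Sum>j\<in>others. (x j)\<^sup>2)" "0 \<le> (\<Sum>j\<in>others. (x j)\<^sup>2)" "0 \<le> (\<Sum>p\<in>unseen. (y p)\<^sup>2)"
    using l by (auto intro: member_le_sum sum_nonneg)
  moreover have "(y (j, l))\<^sup>2 \<le> (\<Sum>p\<in>unseen. (y p)\<^sup>2)" if "j \<noteq> l"
    using u[OF that] member_le_sum[of "(j, l)" unseen "\<lambda>p. (y p)\<^sup>2"] by simp
  ultimately show "(observation l s j)\<^sup>2 \<le> sq_norm s"
    by (auto simp: s)
      (metis add_increasing add_increasing2 zero_le_power2 add.commute order_refl)+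
qed

definition dev :: "nat \<Rightarrow> nat \<Rightarrow> state \<Rightarrow> real" where
  "dev l j s = observation l s j - (LINT s'|P0. observation l s' j)"

text \<open>Indexed by agents instead of tuple positions, so that a relabelling acts directly on the
  indices.\<close>

definition obs_cov :: "nat \<Rightarrow> nat \<Rightarrow> nat \<Rightarrow> real" where
  "obs_cov l j j' = (LINT s|P0. dev l j s * dev l j' s)"

lemma measurable_dev:
  assumes "l \<in> others" "j \<in> others"
  shows "dev l j \<in> borel_measurable (unobserved n i)"
  unfolding dev_def[abs_def] using measurable_observation[OF assms] by simp

lemma integrable_dev_mult:
  assumes "l \<in> others" "j \<in> others" "j' \<in> others"
  shows "integrable P0 (\<lambda>s. dev l j s * dev l j' s)"
proof -
  \<comment> \<open>\<open>M\<close> bounds both means; the summand one gives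
    \<open>1 \<le> M\<^sup>2\<close>, so that one factor dominates the constant and the quadratic
    part.\<close>
  define M where "M = \<bar>LINT s'|P0. observation l s' j\<bar> + \<bar>LINT s'|P0. observation l s' j'\<bar> + 1"
  have b: "\<bar>dev l k s\<bar>\<^sup>2 \<le> 2 * M\<^sup>2 * (1 + sq_norm s)" if "k \<in> {j, j'}" for k s
  proof -
    define a where "a = observation l s k"
    define m where "m = (LINT s'|P0. observation l s' k)"
    have "\<bar>m\<bar> \<le> M" using that by (auto simp: M_def m_def)
    then have m: "m\<^sup>2 \<le> M\<^sup>2" using power_mono[of "\<bar>m\<bar>" M 2] by simp
    have "M \<ge> 1" by (simp add: M_def)
    then have M1: "M\<^sup>2 \<ge> 1" by (simp add: one_le_power)
    have a: "a\<^sup>2 \<le> sq_norm s" 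
      unfolding a_def by (rule observation_sq_le) (use that assms in auto)
    have "(dev l k s)\<^sup>2 = (a - m)\<^sup>2" by (simp add: dev_def a_def m_def)
    also have "\<dots> \<le> 2 * m\<^sup>2 + 2 * a\<^sup>2"
      using zero_le_power2[of "a + m"] by (simp add: power2_eq_square algebra_simps)
    also have "\<dots> \<le> 2 * M\<^sup>2 + 2 * sq_norm s" using a m by simp
    also have "\<dots> \<le> 2 * M\<^sup>2 + 2 * M\<^sup>2 * sq_norm s"
      using M1 sq_norm_nonneg[of s] mult_right_mono[of 1 "M\<^sup>2" "sq_norm s"] by simp
    finally show ?thesis by (simp add: algebra_simps)
  qed
  show ?thesis
  proof (rule integrable_P0)
    show "(\<lambda>s. dev l j s * dev l j' s) \<in> borel_measurable (unobserved n i)"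
      using assms by (intro borel_measurable_times measurable_dev)
    fix s
    have "\<bar>dev l j s * dev l j' s\<bar> \<le> (\<bar>dev l j s\<bar>\<^sup>2 + \<bar>dev l j' s\<bar>\<^sup>2) / 2"
      using zero_le_power2[of "\<bar>dev l j s\<bar> - \<bar>dev l j' s\<bar>"] by (simp add: power2_eq_square abs_mult algebra_simps)
    also have "\<dots> \<le> 2 * M\<^sup>2 * (1 + sq_norm s)"
      using b[of j s] b[of j' s] by simp
    finally show "\<bar>dev l j s * dev l j' s\<bar> \<le> 2 * M\<^sup>2 * (1 + sq_norm s)" .
  qed
qed

lemma integrable_observation:
  assumes "l \<in> others" "j \<in> others"
  shows "integrable P0 (\<lambda>s. observation l s j)"
proof (rule integrable_P0)
  show "(\<lambda>s. observation l s j) \<in> borel_measurable (unobserved n i)"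
    using assms by (rule measurable_observation)
  fix s
  have "0 \<le> (\<bar>observation l s j\<bar> - 1)\<^sup>2" by simp
  then have "\<bar>observation l s j\<bar> \<le> 1 + (observation l s j)\<^sup>2"
    using zero_le_power2[of "observation l s j"] by (simp add: power2_eq_square algebra_simps abs_mult_self)
  then show "\<bar>observation l s j\<bar> \<le> 1 * (1 + sq_norm s)"
    using observation_sq_le[OF assms, of s] by simp
qed

text \<open>Translation by the posterior mean adds \<open>d j\<close> to entry \<open>j\<close> of
  the observation, be it a signal or a link, and deviations from the mean do not see constants.
  Hence the covariance at any observation is the one at the zero observation.\<close>

lemma obs_cov_posterior:
  assumes "l \<in> others" "j \<in> others" "j' \<in> others"
  shows "(LINT s|posterior n \<sigma> \<tau> i v.
     (observation l s j - (LINT s'|posterior n \<sigma> \<tau> i v. observation l s' j)) *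
     (observation l s j' - (LINT s'|posterior n \<sigma> \<tau> i v. observation l s' j'))) = obs_cov l j j'"
proof -
  obtain C where C: "C > 0" "\<And>v s. slice_density n \<sigma> \<tau> i v s = C * exp (- energy v s)"
    using slice_density_eq_exp by blast
  obtain c d e K where tr: "\<And>s. energy v (affine_map id c d e s) = energy (\<lambda>_. 0) s + K"
    and e: "\<And>p. p \<in> unseen \<Longrightarrow> fst p \<noteq> i \<Longrightarrow> e p = d (fst p)"
    by (rule energy_translate[of v]) blast
  have sl: "slice_density n \<sigma> \<tau> i v (affine_map id c d e s) = exp (- K) * slice_density n \<sigma> \<tau> i (\<lambda>_. 0) s" for s
    by (simp add: C tr exp_diff exp_minus field_simps)
  have id: "id permutes others" by (rule permutes_id)
  note T = integral_posterior_affine[OF id _ _ sl]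
  have ob: "observation l (affine_map id c d e s) k = observation l s k + d k" if "k \<in> others" for s k
  proof -
    have "(k, l) \<in> unseen \<and> k \<noteq> i" if "k \<noteq> l"
      using that \<open>k \<in> others\<close> assms by (auto simp: unseen_def links_def others_def)
    then show ?thesis
      using e[of "(k, l)"] assms(1) by (cases s) (auto simp: affine_map_def)
  qed
  interpret prob_space P0 by (rule prob_space_P0)
  have m: "(LINT s'|posterior n \<sigma> \<tau> i v. observation l s' k) = (LINT s'|P0. observation l s' k) + d k"
    if "k \<in> others" for k
    using that assms integrable_observation[OF assms(1) that] prob_space
    by (subst T) (auto simp: ob measurable_observation)
  show ?thesis
    unfolding m[OF assms(2)] m[OF assms(3)]
    by (subst T) (use assms in \<open>auto simp: ob obs_cov_def dev_def intro!: borel_measurable_times borel_measurable_diff measurable_observation\<close>)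
qed

text \<open>The zero observation is invariant under relabelling, and so is its energy. In the
  relabelled state, agent \<open>l\<close> has at entry \<open>j\<close> what \<open>p l\<close> had
  at entry \<open>p j\<close>.\<close>

lemma obs_cov_permute:
  assumes p: "p permutes others" and lj: "l \<in> others" "j \<in> others" "j' \<in> others"
  shows "obs_cov (p l) (p j) (p j') = obs_cov l j j'"
proof -
  obtain C where C: "C > 0" "\<And>v s. slice_density n \<sigma> \<tau> i v s = C * exp (- energy v s)"
    using slice_density_eq_exp by blast
  let ?F = "affine_map p 0 (\<lambda>_. 0) (\<lambda>_. 0)"
  have pi: "p i = i" using p by (simp add: others_def permutes_not_in)
  have inj: "p a = p b \<longleftrightarrow> a = b" for a b
    using permutes_inj[OF p] by (auto simp: inj_eq)
  have "energy (\<lambda>_. 0) (?F (\<theta>, x, y)) = energy (\<lambda>_. 0) (\<theta>, x, y)" for \<theta> x y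
  proof -
    have "signals (\<lambda>_. 0) (\<lambda>j\<in>others. x (p j)) (fst q) = signals (\<lambda>_. 0) x (fst (map_prod p p q))" if "q \<in> unseen" for q
      using that inj[of _ i] pi by (cases q) (auto simp: signals_def unseen_def links_def others_def)
    then have "energy (\<lambda>_. 0) (?F (\<theta>, x, y)) =
       (\<theta>\<^sup>2 + (\<Sum>j\<in>others. (x (p j) - \<theta>)\<^sup>2)) / (2 * \<sigma>\<^sup>2) +
       ((\<Sum>j\<in>others. (x (p j))\<^sup>2)
         + (\<Sum>q\<in>unseen. (y (map_prod p p q) - signals (\<lambda>_. 0) x (fst (map_prod p p q)))\<^sup>2)) / (2 * \<tau>\<^sup>2)"
      by (simp add: affine_map_def cong: sum.cong)
    then show ?thesis
      using sum.reindex_bij_betw[OF permutes_imp_bij[OF p], of "\<lambda>j. (x j - \<theta>)\<^sup>2"]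
        sum.reindex_bij_betw[OF permutes_imp_bij[OF p], of "\<lambda>j. (x j)\<^sup>2"]
        sum.reindex_bij_betw[OF bij_betw_unseen[OF p], of "\<lambda>q. (y q - signals (\<lambda>_. 0) x (fst q))\<^sup>2"]
      by simp
  qed
  then have sl: "slice_density n \<sigma> \<tau> i (\<lambda>_. 0) (?F s) = 1 * slice_density n \<sigma> \<tau> i (\<lambda>_. 0) s" for s
    by (cases s) (simp add: C)
  note T = integral_posterior_affine[OF p _ _ sl]
  have ob: "observation l (?F s) k = observation (p l) s (p k)" if "k \<in> others" for s k
  proof -
    have "(k, l) \<in> unseen" if "k \<noteq> l"
      using that \<open>k \<in> others\<close> lj by (auto simp: unseen_def links_def others_def)
    then show ?thesis
      using lj(1) by (cases s) (auto simp: affine_map_def inj)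
  qed
  have m: "(LINT s'|P0. observation l s' k) = (LINT s'|P0. observation (p l) s' (p k))" if "k \<in> others" for k
    using that lj by (subst T) (auto simp: ob measurable_observation)
  show ?thesis
    unfolding obs_cov_def
    by (subst (2) T) (use lj in \<open>auto simp: ob dev_def m intro!: borel_measurable_times borel_measurable_diff measurable_observation\<close>)
qed

end

section \<open>The operator on the completed observation\<close>

lemma std_normal_cdf_bounds:
  "0 \<le> cdf std_normal_distribution x" "cdf std_normal_distribution x \<le> 1"
proof -
  interpret real_distribution std_normal_distribution by (rule real_dist_normal_dist)
  show "0 \<le> cdf std_normal_distribution x" "cdf std_normal_distribution x \<le> 1"
    by (rule cdf_nonneg) (rule cdf_bounded_prob)
qed

text \<open>The normal density is at most one. This constant, rather than the sharper
  \<open>1 / sqrt (2 * pi)\<close>, is the one compatible with the form of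
  \<open>coef_w\<close>.\<close>

lemma std_normal_cdf_lipschitz:
  "\<bar>cdf std_normal_distribution x - cdf std_normal_distribution y\<bar> \<le> \<bar>x - y\<bar>"
proof -
  interpret real_distribution std_normal_distribution by (rule real_dist_normal_dist)
  have *: "cdf std_normal_distribution y - cdf std_normal_distribution x \<le> y - x" if "x < y" for x y
  proof -
    have d1: "std_normal_density t \<le> 1" for t
    proof -
      have "exp (- t\<^sup>2 / 2) \<le> 1" by simp
      moreover have "sqrt (2 * pi) \<ge> 1" using pi_gt3 by (simp add: real_le_rsqrt)
      ultimately have "exp (- t\<^sup>2 / 2) \<le> sqrt (2 * pi)" by linarith
      then show ?thesis
        unfolding std_normal_density_def by (simp add: divide_le_eq)
    qed
    have "emeasure std_normal_distribution {x<..y} = (\<integral>\<^sup>+t. ennreal (std_normal_density t) * indicator {x<..y} t \<partial>lborel)"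
      by (subst emeasure_density) auto
    also have "\<dots> \<le> (\<integral>\<^sup>+t. 1 * indicator {x<..y} t \<partial>lborel)"
      using d1 by (intro nn_integral_mono mult_right_mono) auto
    also have "\<dots> = ennreal (y - x)" using that by simp
    finally have "measure std_normal_distribution {x<..y} \<le> y - x"
      using that unfolding measure_def by (metis enn2real_leI less_imp_le diff_ge_0_iff_ge)
    then show ?thesis using cdf_diff_eq[OF that] by simp
  qed
  have mono: "cdf std_normal_distribution x \<le> cdf std_normal_distribution y" if "x < y" for x y
    using that by (intro cdf_nondecreasing) simp
  show ?thesis
    using *[of x y] *[of y x] mono[of x y] mono[of y x] by (cases x y rule: linorder_cases) auto
qed

lemma continuous_on_std_normal_cdf: "continuous_on UNIV (cdf std_normal_distribution)"
  unfolding continuous_on_iff dist_real_def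
  using std_normal_cdf_lipschitz by (meson le_less_trans)

lemma measurable_std_normal_cdf [measurable]: "cdf std_normal_distribution \<in> borel_measurable borel"
  by (rule borel_measurable_continuous_onI) (rule continuous_on_std_normal_cdf)

text \<open>\<open>positions\<close> pins the type variable \<open>'m\<close> within the locale, so
  that all declarations speak about the same space of tuples.\<close>

locale equilibrium = observer n i \<sigma> \<tau> for n i :: nat and \<sigma> \<tau> :: real +
  fixes k :: nat and positions :: "'m::{finite,linorder} itself"
  assumes k_agent: "k \<in> {1..n}" "k \<noteq> i" and card_positions: "CARD('m) + 1 = n"
begin

abbreviation "a \<equiv> coef_a \<sigma> \<tau> n"
abbreviation "b \<equiv> coef_b \<sigma> \<tau> n"
abbreviation "e \<equiv> coef_e \<sigma> \<tau> n"
abbreviation "s \<equiv> real n * a + (real n - 2) * b"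
abbreviation "\<Phi> \<equiv> cdf std_normal_distribution"

section \<open>Bounds on the coefficients and on the centers\<close>

lemma eta_sq_pos: "m \<ge> 1 \<Longrightarrow> eta_sq \<sigma> \<tau> m > 0"
  using \<sigma>_pos \<tau>_pos by (simp add: eta_sq_def add_pos_nonneg add_pos_pos)

lemma coef_pos: "m \<ge> 1 \<Longrightarrow> coef_a \<sigma> \<tau> m > 0" "m \<ge> 1 \<Longrightarrow> coef_b \<sigma> \<tau> m > 0"
  using eta_sq_pos \<sigma>_pos \<tau>_pos by (simp_all add: coef_a_def coef_b_def add_pos_pos)

lemma a_pos: "a > 0" and b_pos: "b > 0"
  using coef_pos[of n] n_ge_2 by auto

lemma b_le_a: "b \<le> a"
  unfolding coef_a_def coef_b_def
  using eta_sq_pos[of n] n_ge_2 \<sigma>_pos \<tau>_pos by (intro divide_left_mono) (auto intro!: mult_pos_pos add_pos_pos)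

lemma s_nonneg: "s \<ge> 0"
  using a_pos b_pos n_ge_2 by simp

lemma gamma_sq_pos: "gamma_sq \<sigma> \<tau> n > 0"
proof -
  have "eta_sq \<sigma> \<tau> (n - 1) > 0" using n_ge_2 by (intro eta_sq_pos) simp
  then show ?thesis using \<sigma>_pos \<tau>_pos by (simp add: gamma_sq_def add_pos_pos)
qed

lemma center_coef_bounds:
  "0 \<le> coef_c \<sigma> \<tau> n * coef_a \<sigma> \<tau> (n - 1)" "coef_c \<sigma> \<tau> n * coef_a \<sigma> \<tau> (n - 1) \<le> e"
  "0 \<le> coef_d \<sigma> \<tau> n" "coef_d \<sigma> \<tau> n \<le> e"
  "0 \<le> coef_c \<sigma> \<tau> n * coef_b \<sigma> \<tau> (n - 1)" "coef_c \<sigma> \<tau> n * coef_b \<sigma> \<tau> (n - 1) \<le> e"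
proof -
  have "eta_sq \<sigma> \<tau> (n - 1) > 0" using n_ge_2 by (intro eta_sq_pos) simp
  then have c: "coef_c \<sigma> \<tau> n \<ge> 0"
    using gamma_sq_pos by (simp add: coef_c_def)
  show "0 \<le> coef_c \<sigma> \<tau> n * coef_a \<sigma> \<tau> (n - 1)" "0 \<le> coef_c \<sigma> \<tau> n * coef_b \<sigma> \<tau> (n - 1)"
    using c coef_pos[THEN less_imp_le, of "n - 1"] n_ge_2 by (auto intro!: mult_nonneg_nonneg)
  show "0 \<le> coef_d \<sigma> \<tau> n"
    using gamma_sq_pos by (simp add: coef_d_def)
qed (simp_all add: coef_e_def)

lemma e_nonneg: "e \<ge> 0"
  using center_coef_bounds by linarith

text \<open>\<open>e\<close> is the largest of the three coefficients with which entries of an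
  observation enter a center, and each agent's entry enters exactly once.\<close>

lemma center_diff:
  assumes j: "j \<in> others"
  shows "\<bar>center n \<sigma> \<tau> i v j - center n \<sigma> \<tau> i v' j\<bar> \<le> e * (\<Sum>m\<in>{1..n}. \<bar>v m - v' m\<bar>)"
proof -
  have cb: "\<bar>c * x\<bar> \<le> e * \<bar>x\<bar>" if "0 \<le> c" "c \<le> e" for c x :: real
    using that by (simp add: abs_mult mult_right_mono)
  let ?A = "{1..n} - {i, j}"
  have "center n \<sigma> \<tau> i v j - center n \<sigma> \<tau> i v' j =
      coef_c \<sigma> \<tau> n * coef_a \<sigma> \<tau> (n - 1) * (v i - v' i) + coef_d \<sigma> \<tau> n * (v j - v' j)
      + coef_c \<sigma> \<tau> n * coef_b \<sigma> \<tau> (n - 1) * (\<Sum>m\<in>?A. v m - v' m)"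
    by (simp add: center_def sum_subtractf algebra_simps)
  also have "\<bar>\<dots>\<bar> \<le> e * \<bar>v i - v' i\<bar> + e * \<bar>v j - v' j\<bar> + e * \<bar>\<Sum>m\<in>?A. v m - v' m\<bar>"
    using cb center_coef_bounds by (intro order_trans[OF abs_triangle_ineq] add_mono) auto
  also have "\<dots> \<le> e * \<bar>v i - v' i\<bar> + e * \<bar>v j - v' j\<bar> + e * (\<Sum>m\<in>?A. \<bar>v m - v' m\<bar>)"
    using e_nonneg by (intro add_left_mono mult_left_mono sum_abs)
  also have "\<dots> = e * (\<Sum>m\<in>insert i (insert j ?A). \<bar>v m - v' m\<bar>)"
    using j by (simp add: others_def algebra_simps)
  also have "insert i (insert j ?A) = {1..n}"
    using i_agent j by (auto simp: others_def)
  finally show ?thesis .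
qed

text \<open>The position that \<open>slot\<close> assigns to the owner of a tuple; all other
  positions carry reports about the remaining agents.\<close>

definition head :: 'm where "head = Min UNIV"

lemma card_less_head: "card {r. r < head} = 0"
proof -
  have "\<not> r < head" for r unfolding head_def not_less by (rule Min_le) auto
  then show ?thesis by simp
qed

lemma slot_head: "slot n l j head = l"
  by (simp add: slot_def card_less_head)

lemma k_others: "k \<in> others" using k_agent by (simp add: others_def)

lemma bij_slot: "l \<in> others \<Longrightarrow> bij_betw (slot n l i :: 'm \<Rightarrow> nat) UNIV others"
  using bij_betw_slot[where 'm='m, OF card_positions, of l i] i_agent by (auto simp: others_def)

lemma bij_slot_k: "bij_betw (slot n i k :: 'm \<Rightarrow> nat) UNIV ({1..n} - {k})"
  using bij_betw_slot[where 'm='m, OF card_positions, of i k] i_agent k_agent by auto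

text \<open>\<open>b * \<tau>\<close> times the argument of \<open>\<Phi>\<close> in \<open>M_op\<close>, up to the term \<open>b * v i\<close>.\<close>

definition excess :: "((real, 'm) vec \<Rightarrow> real) \<Rightarrow> (real, 'm) vec \<Rightarrow> real" where
  "excess g z = g z - a * z $ head - b * (\<Sum>r\<in>UNIV - {head}. z $ r)"

definition noise_cov :: "nat \<Rightarrow> ((real, 'm) vec, 'm) vec" where
  "noise_cov l = (\<chi> r r'. obs_cov l (slot n l i r) (slot n l i r'))"

abbreviation "noise l \<equiv> centered_gaussian_density (noise_cov l)"

text \<open>\<open>M_op\<close> as a function of an arbitrary full observation instead of one
  completed by \<open>g\<close>. In this form no entry other than that of \<open>i\<close> is
  distinguished.\<close>

definition belief :: "((real, 'm) vec \<Rightarrow> real) \<Rightarrow> (nat \<Rightarrow> real) \<Rightarrow> nat \<Rightarrow> (real, 'm) vec \<Rightarrow> real" where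
  "belief g v l \<epsilon> = (excess g (tuple_of n l i (center n \<sigma> \<tau> i v) + \<epsilon>) - b * v i) / (b * \<tau>)"

text \<open>The function \<open>S g\<close> of the overview. It is needed on all observations, since
  the zero set argument evaluates it where \<open>h_fun\<close> is not yet known to vanish.\<close>

definition participation :: "((real, 'm) vec \<Rightarrow> real) \<Rightarrow> (nat \<Rightarrow> real) \<Rightarrow> real" where
  "participation g v = 1 + (\<Sum>l\<in>others. LINT \<epsilon>|lborel. \<Phi> (belief g v l \<epsilon>) * noise l \<epsilon>)"

lemma slot_others: "l \<in> others \<Longrightarrow> slot n l i (r :: 'm) \<in> others"
  using bij_slot by (auto dest: bij_betwE)

lemma cond_cov_eq: "l \<in> others \<Longrightarrow> cond_cov n \<sigma> \<tau> i l v = noise_cov l"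
  by (simp add: cond_cov_def noise_cov_def obs_cov_posterior slot_others)

text \<open>The quadratic form is the expectation of the square of a linear combination of
  deviations.\<close>

lemma noise_cov_psd:
  assumes l: "l \<in> others"
  shows "transpose (noise_cov l) = noise_cov l" and "x \<bullet> (noise_cov l *v x) \<ge> 0"
proof -
  show "transpose (noise_cov l) = noise_cov l"
    by (simp add: transpose_def noise_cov_def obs_cov_def mult.commute)
  let ?d = "\<lambda>r. dev l (slot n l i (r :: 'm))"
  have I: "integrable P0 (\<lambda>s. ?d r s * ?d r' s)" for r r'
    using l by (intro integrable_dev_mult slot_others)
  have "x \<bullet> (noise_cov l *v x) = (\<Sum>r\<in>UNIV. \<Sum>r'\<in>UNIV. LINT s|P0. x $ r * x $ r' * (?d r s * ?d r' s))"
    by (simp add: inner_vec_def matrix_vector_mult_def noise_cov_def obs_cov_def sum_distrib_left mult_ac)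
  also have "\<dots> = (LINT s|P0. (\<Sum>r\<in>UNIV. \<Sum>r'\<in>UNIV. x $ r * x $ r' * (?d r s * ?d r' s)))"
    using I by (simp add: Bochner_Integration.integral_sum)
  also have "\<dots> = (LINT s|P0. (\<Sum>r\<in>UNIV. x $ r * ?d r s)\<^sup>2)"
    by (simp add: power2_eq_square sum_product mult_ac)
  also have "\<dots> \<ge> 0" by (rule Bochner_Integration.integral_nonneg) simp
  finally show "x \<bullet> (noise_cov l *v x) \<ge> 0" .
qed

lemma noise_facts:
  assumes "l \<in> others"
  shows noise_nonneg: "noise l \<epsilon> \<ge> 0" and integrable_noise: "integrable lborel (noise l)"
    and integral_noise_le: "(LINT \<epsilon>|lborel. noise l \<epsilon>) \<le> 1"
  using noise_cov_psd[OF assms]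
  by (auto intro: centered_gaussian_density_psd integrable_centered_gaussian_density)

text \<open>Since \<open>head\<close> carries agent \<open>l\<close>, the sum over the remaining
  agents in \<open>M_op\<close> becomes a sum over the remaining positions. The covariance in
  \<open>T_op\<close> loses its dependence on the completed observation by
  \<open>cond_cov_eq\<close>.\<close>

lemma T_op_eq_participation:
  fixes g :: "(real, 'm) vec \<Rightarrow> real"
  shows "T_op n \<sigma> \<tau> i k g y = participation g (completion n \<sigma> \<tau> i k g y)"
proof -
  define v where "v = completion n \<sigma> \<tau> i k g y"
  have M: "M_op n \<sigma> \<tau> i k \<epsilon> l g y = belief g v l \<epsilon>" if l: "l \<in> others" for l \<epsilon>
  proof -
    define z where "z = tuple_of n l i (center n \<sigma> \<tau> i v) + \<epsilon>"
    have bij: "bij_betw (slot n l i :: 'm \<Rightarrow> nat) UNIV others" by (rule bij_slot[OF l])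
    have fam: "family_of n l i z (slot n l i r) = z $ r" for r :: 'm
      using bij by (simp add: family_of_def bij_betw_def)
    have "bij_betw (slot n l i :: 'm \<Rightarrow> nat) (UNIV - {head}) (others - {l})"
      using bij_betw_DiffI[OF bij, of "{head}" "{l}"] l by (simp add: slot_head bij_betw_def)
    then have "(\<Sum>j\<in>others - {l}. family_of n l i z j) = (\<Sum>r\<in>UNIV - {head}. z $ r)"
      by (subst sum.reindex_bij_betw[symmetric]) (auto simp: fam)
    moreover have "others - {l} = {1..n} - {i, l}" by (auto simp: others_def)
    moreover have "family_of n l i z l = z $ head"
      using fam[of head] by (simp add: slot_head)
    ultimately show ?thesis
      by (simp add: M_op_def Let_def v_def[symmetric] z_def[symmetric] belief_def excess_def)
  qed
  have "{1..n} - {i} = others" by (simp add: others_def)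
  then show ?thesis
    unfolding T_op_def participation_def v_def[symmetric]
    by (simp add: M cond_cov_eq cong: sum.cong)
qed

section \<open>Lipschitz and symmetry properties of participation\<close>

definition lip :: "((real, 'm) vec \<Rightarrow> real) \<Rightarrow> bool" where
  "lip g \<longleftrightarrow> (\<forall>y z. \<bar>g y - g z\<bar> \<le> a * (\<Sum>r\<in>UNIV. \<bar>y $ r - z $ r\<bar>))"

definition tail_symmetric :: "((real, 'm) vec \<Rightarrow> real) \<Rightarrow> bool" where
  "tail_symmetric g \<longleftrightarrow> (\<forall>\<rho> z. bij \<rho> \<longrightarrow> \<rho> head = head \<longrightarrow> g (\<chi> r. z $ \<rho> r) = g z)"

lemma lip_continuous:
  assumes "lip g"
  shows "continuous_on UNIV g"
proof (rule continuous_at_imp_continuous_on, rule ballI)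
  fix z :: "(real, 'm) vec"
  have "((\<lambda>y. a * (\<Sum>r\<in>UNIV. \<bar>y $ r - z $ r\<bar>)) \<longlongrightarrow> a * (\<Sum>r\<in>(UNIV::'m set). \<bar>z $ r - z $ r\<bar>)) (at z)"
    by (intro tendsto_intros)
  then have "((\<lambda>y. a * (\<Sum>r\<in>UNIV. \<bar>y $ r - z $ r\<bar>)) \<longlongrightarrow> 0) (at z)" by simp
  then have "((\<lambda>y. g y - g z) \<longlongrightarrow> 0) (at z)"
    by (rule Lim_null_comparison[rotated]) (use assms in \<open>auto simp: lip_def\<close>)
  then show "isCont g z"
    unfolding isCont_def by (simp add: LIM_zero_iff)
qed

lemma measurable_belief:
  assumes "lip g"
  shows "belief g v l \<in> borel_measurable borel"
proof -
  have "continuous_on UNIV (excess g)"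
    unfolding excess_def[abs_def] by (intro continuous_intros lip_continuous assms)
  then have [measurable]: "excess g \<in> borel_measurable borel"
    by (rule borel_measurable_continuous_onI)
  show ?thesis
    unfolding belief_def[abs_def] by measurable
qed

lemma integrable_participation:
  assumes "lip g" "l \<in> others"
  shows "integrable lborel (\<lambda>\<epsilon>. \<Phi> (belief g v l \<epsilon>) * noise l \<epsilon>)"
proof (rule Bochner_Integration.integrable_bound[OF integrable_noise[OF assms(2)]])
  show "(\<lambda>\<epsilon>. \<Phi> (belief g v l \<epsilon>) * noise l \<epsilon>) \<in> borel_measurable lborel"
    using measurable_belief[OF assms(1)] by measurable
  show "AE \<epsilon> in lborel. norm (\<Phi> (belief g v l \<epsilon>) * noise l \<epsilon>) \<le> norm (noise l \<epsilon>)"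
    using std_normal_cdf_bounds by (intro AE_I2) (auto simp: abs_mult intro!: mult_left_le_one_le)
qed

lemma card_others: "card others = n - 1"
  using i_agent by (simp add: others_def)

lemma participation_bounds:
  assumes "lip g"
  shows "1 \<le> participation g v" "participation g v \<le> n"
proof -
  let ?I = "\<lambda>l. LINT \<epsilon>|lborel. \<Phi> (belief g v l \<epsilon>) * noise l \<epsilon>"
  have 0: "0 \<le> ?I l" if "l \<in> others" for l
    using noise_nonneg[OF that] std_normal_cdf_bounds by (intro Bochner_Integration.integral_nonneg) simp
  have "?I l \<le> 1" if "l \<in> others" for l
  proof -
    have "?I l \<le> (LINT \<epsilon>|lborel. noise l \<epsilon>)"
      using integrable_participation[OF assms that] integrable_noise[OF that] noise_nonneg[OF that] std_normal_cdf_bounds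
      by (intro integral_mono) (auto intro!: mult_left_le_one_le)
    also have "\<dots> \<le> 1" by (rule integral_noise_le[OF that])
    finally show ?thesis .
  qed
  then have "(\<Sum>l\<in>others. ?I l) \<le> real (card others) * 1" by (rule sum_bounded_above)
  then show "participation g v \<le> n"
    using n_ge_2 by (simp add: participation_def card_others of_nat_diff)
  show "1 \<le> participation g v"
    using 0 by (simp add: participation_def sum_nonneg)
qed

text \<open>Origin of \<open>s\<close>: the Lipschitz bound on \<open>g\<close> contributes
  \<open>a\<close> for each of the \<open>n - 1\<close> positions, the linear terms contribute one
  more \<open>a\<close> at \<open>head\<close> and \<open>b\<close> at each of the
  \<open>n - 2\<close> other positions.\<close>

lemma excess_diff:
  assumes "lip g" and D: "\<And>z. \<bar>g z - g' z\<bar> \<le> D" and \<delta>: "\<And>r. \<bar>z $ r - z' $ r\<bar> \<le> \<delta>"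
  shows "\<bar>excess g z - excess g' z'\<bar> \<le> D + s * \<delta>"
proof -
  have card: "real CARD('m) = real n - 1" using card_positions by simp
  have "\<bar>g z - g z'\<bar> \<le> a * (\<Sum>r\<in>UNIV. \<bar>z $ r - z' $ r\<bar>)"
    using assms(1) by (simp add: lip_def)
  also have "\<dots> \<le> a * (real CARD('m) * \<delta>)"
    using a_pos \<delta> by (intro mult_left_mono sum_bounded_above) auto
  finally have 1: "\<bar>g z - g z'\<bar> \<le> a * ((real n - 1) * \<delta>)" by (simp add: card)
  have "\<bar>\<Sum>r\<in>UNIV - {head}. z $ r - z' $ r\<bar> \<le> (\<Sum>r\<in>UNIV - {head}. \<bar>z $ r - z' $ r\<bar>)"
    by (rule sum_abs)
  also have "\<dots> \<le> real (card (UNIV - {head :: 'm})) * \<delta>"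
    using \<delta> by (intro sum_bounded_above) auto
  also have "real (card (UNIV - {head :: 'm})) = real n - 2"
    using card_positions n_ge_2 by (simp add: card_Diff_subset)
  finally have "b * \<bar>\<Sum>r\<in>UNIV - {head}. z $ r - z' $ r\<bar> \<le> b * ((real n - 2) * \<delta>)"
    using b_pos by (intro mult_left_mono) auto
  then have 2: "\<bar>b * (\<Sum>r\<in>UNIV - {head}. z $ r - z' $ r)\<bar> \<le> b * ((real n - 2) * \<delta>)"
    using b_pos by (simp add: abs_mult)
  have 3: "\<bar>a * (z $ head - z' $ head)\<bar> \<le> a * \<delta>"
    using \<delta>[of head] a_pos by (simp add: abs_mult)
  have "excess g z - excess g' z' = (g z' - g' z') + (g z - g z') - a * (z $ head - z' $ head)
      - b * (\<Sum>r\<in>UNIV - {head}. z $ r - z' $ r)"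
    by (simp add: excess_def sum_subtractf algebra_simps)
  then have "\<bar>excess g z - excess g' z'\<bar> \<le> D + a * ((real n - 1) * \<delta>) + a * \<delta> + b * ((real n - 2) * \<delta>)"
    using D[of z'] 1 2 3 by linarith
  also have "\<dots> = D + s * \<delta>" by (simp add: algebra_simps)
  finally show ?thesis .
qed

text \<open>One estimate for all sources of variation: \<open>D\<close> for the function,
  \<open>V\<close> for the centers and \<open>X\<close> for the own signal. The Lipschitz bound, the
  contraction and the uniqueness of the entry \<open>k\<close> are its instances with
  \<open>D = 0\<close>, with \<open>X = 0\<close>, and with both zero.\<close>

lemma participation_diff:
  assumes g: "lip g" "lip g'" and D: "\<And>z. \<bar>g z - g' z\<bar> \<le> D"
    and V: "(\<Sum>m\<in>{1..n}. \<bar>v m - v' m\<bar>) \<le> V" and X: "\<bar>v i - v' i\<bar> \<le> X"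
  shows "\<bar>participation g v - participation g' v'\<bar> \<le> (real n - 1) * ((D + s * (e * V) + b * X) / (b * \<tau>))"
proof -
  define K where "K = (D + s * (e * V) + b * X) / (b * \<tau>)"
  let ?I = "\<lambda>g v l. LINT \<epsilon>|lborel. \<Phi> (belief g v l \<epsilon>) * noise l \<epsilon>"
  have "\<bar>?I g v l - ?I g' v' l\<bar> \<le> K" if l: "l \<in> others" for l
  proof -
    have B: "\<bar>belief g v l \<epsilon> - belief g' v' l \<epsilon>\<bar> \<le> K" for \<epsilon>
    proof -
      let ?z = "tuple_of n l i (center n \<sigma> \<tau> i v) + \<epsilon>" and ?z' = "tuple_of n l i (center n \<sigma> \<tau> i v') + \<epsilon>"
      have "\<bar>?z $ r - ?z' $ r\<bar> \<le> e * V" for r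
        using order_trans[OF center_diff[OF slot_others[OF l, of r]] mult_left_mono[OF V e_nonneg]]
        by (simp add: tuple_of_def)
      then have "\<bar>excess g ?z - excess g' ?z'\<bar> \<le> D + s * (e * V)"
        by (rule excess_diff[OF g(1) D])
      moreover have "\<bar>b * (v i - v' i)\<bar> \<le> b * X"
        using X b_pos by (simp add: abs_mult)
      ultimately have "\<bar>(excess g ?z - b * v i) - (excess g' ?z' - b * v' i)\<bar> \<le> D + s * (e * V) + b * X"
        by (simp add: algebra_simps)
      then have "\<bar>(excess g ?z - b * v i) - (excess g' ?z' - b * v' i)\<bar> / (b * \<tau>) \<le> K"
        unfolding K_def using b_pos \<tau>_pos by (intro divide_right_mono) auto
      then show ?thesis
        unfolding belief_def diff_divide_distrib[symmetric] using b_pos \<tau>_pos by (simp add: abs_mult)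
    qed
    \<comment> \<open>Nonnegativity is needed because the noise may have mass below one: only then
      does \<open>K\<close> times the mass stay below \<open>K\<close>.\<close>
    have K0: "K \<ge> 0" using B[of 0] by linarith
    note I = integrable_participation[OF g(1) l, of v] integrable_participation[OF g(2) l, of v']
    have "\<bar>?I g v l - ?I g' v' l\<bar> = \<bar>LINT \<epsilon>|lborel. \<Phi> (belief g v l \<epsilon>) * noise l \<epsilon> - \<Phi> (belief g' v' l \<epsilon>) * noise l \<epsilon>\<bar>"
      using I by simp
    also have "\<dots> \<le> (LINT \<epsilon>|lborel. \<bar>\<Phi> (belief g v l \<epsilon>) * noise l \<epsilon> - \<Phi> (belief g' v' l \<epsilon>) * noise l \<epsilon>\<bar>)"
      by (rule integral_abs_bound)
    also have "\<dots> \<le> (LINT \<epsilon>|lborel. K * noise l \<epsilon>)"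
    proof (rule integral_mono)
      fix \<epsilon>
      have "\<bar>\<Phi> (belief g v l \<epsilon>) - \<Phi> (belief g' v' l \<epsilon>)\<bar> \<le> K"
        using std_normal_cdf_lipschitz B by (rule order_trans)
      then show "\<bar>\<Phi> (belief g v l \<epsilon>) * noise l \<epsilon> - \<Phi> (belief g' v' l \<epsilon>) * noise l \<epsilon>\<bar> \<le> K * noise l \<epsilon>"
        using noise_nonneg[OF l, of \<epsilon>] unfolding left_diff_distrib[symmetric] abs_mult
        by (simp add: mult_right_mono)
    qed (use I integrable_noise[OF l] in auto)
    also have "\<dots> \<le> K"
      using K0 integral_noise_le[OF l] mult_left_mono[OF integral_noise_le[OF l] K0] by simp
    finally show ?thesis .
  qed
  then have "(\<Sum>l\<in>others. \<bar>?I g v l - ?I g' v' l\<bar>) \<le> real (card others) * K"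
    by (rule sum_bounded_above)
  moreover have "\<bar>participation g v - participation g' v'\<bar> \<le> (\<Sum>l\<in>others. \<bar>?I g v l - ?I g' v' l\<bar>)"
    unfolding participation_def by (simp add: sum_subtractf[symmetric] sum_abs)
  moreover have "real (card others) = real n - 1"
    using n_ge_2 by (simp add: card_others of_nat_diff)
  ultimately show ?thesis unfolding K_def by simp
qed

text \<open>The previous estimate with all three variations zero. Observations are functions on all
  of \<open>nat\<close>, and completed ones agree with given ones only on the agents.\<close>

lemma participation_cong:
  assumes "lip g" "\<And>m. m \<in> {1..n} \<Longrightarrow> v m = v' m"
  shows "participation g v = participation g v'"
  using participation_diff[OF assms(1) assms(1), of 0 v v' 0 0] assms(2) i_agent by simp

text \<open>The permutation carries the summand of \<open>l\<close> to that of
  \<open>\<pi> l\<close>. Centers commute with \<open>\<pi>\<close>, the two tuples differ by a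
  reordering of positions, and this reordering is absorbed by tail symmetry of \<open>g\<close>, by
  the covariance symmetry and by a substitution in the noise variable.\<close>

lemma participation_permute:
  assumes g: "lip g" "tail_symmetric g" and \<pi>: "\<pi> permutes others"
  shows "participation g (v \<circ> \<pi>) = participation g v"
proof -
  let ?I = "\<lambda>v l. LINT \<epsilon>|lborel. \<Phi> (belief g v l \<epsilon>) * noise l \<epsilon>"
  have pi: "\<pi> i = i" using \<pi> by (simp add: others_def permutes_not_in)
  have bij\<pi>: "bij_betw \<pi> others others" using \<pi> by (rule permutes_imp_bij)
  have cent: "center n \<sigma> \<tau> i (v \<circ> \<pi>) j = center n \<sigma> \<tau> i v (\<pi> j)" if j: "j \<in> others" for j
  proof -
    have "bij_betw \<pi> (others - {j}) (others - {\<pi> j})"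
      using bij_betw_DiffI[OF bij\<pi>, of "{j}" "{\<pi> j}"] j bij\<pi> by (auto simp: bij_betw_def)
    moreover have "others - {j} = {1..n} - {i, j}" for j by (auto simp: others_def)
    ultimately have "(\<Sum>m\<in>{1..n} - {i, j}. v (\<pi> m)) = (\<Sum>m\<in>{1..n} - {i, \<pi> j}. v m)"
      by (metis sum.reindex_bij_betw)
    then show ?thesis by (simp add: center_def pi)
  qed
  have "?I (v \<circ> \<pi>) l = ?I v (\<pi> l)" if l: "l \<in> others" for l
  proof -
    have \<pi>l: "\<pi> l \<in> others" using bij\<pi> l by (auto dest: bij_betwE)
    let ?sl = "slot n l i :: 'm \<Rightarrow> nat" and ?sl' = "slot n (\<pi> l) i :: 'm \<Rightarrow> nat"
    \<comment> \<open>Positions are filled in increasing order of agents, which \<open>\<pi>\<close>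
      need not respect. \<open>\<rho>\<close> sends the position of \<open>j\<close> in the tuple of
      \<open>l\<close> to the position of \<open>\<pi> j\<close> in the tuple of
      \<open>\<pi> l\<close>, and therefore fixes \<open>head\<close>.\<close>
    define \<rho> where "\<rho> = inv ?sl' \<circ> \<pi> \<circ> ?sl"
    have inv: "bij_betw (inv ?sl') others UNIV"
      by (rule bij_betw_inv_into[OF bij_slot[OF \<pi>l]])
    have bij: "bij \<rho>"
      unfolding \<rho>_def comp_assoc
      by (rule bij_betw_trans[OF bij_betw_trans[OF bij_slot[OF l] bij\<pi>] inv, unfolded comp_assoc])
    have sl: "?sl' (\<rho> r) = \<pi> (?sl r)" for r
    proof -
      have "\<pi> (?sl r) \<in> range ?sl'"
        using bij_slot[OF \<pi>l] bij\<pi> slot_others[OF l, of r] by (auto simp: bij_betw_def)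
      then show ?thesis unfolding \<rho>_def by (simp add: f_inv_into_f)
    qed
    have "?sl' (\<rho> head) = ?sl' head" by (simp add: sl slot_head)
    then have \<rho>h: "\<rho> head = head"
      using bij_slot[OF \<pi>l] by (simp add: bij_betw_def inj_eq)
    let ?P = "\<lambda>z::(real, 'm) vec. \<chi> r. z $ \<rho> r"
    have tup: "tuple_of n l i (center n \<sigma> \<tau> i (v \<circ> \<pi>)) = ?P (tuple_of n (\<pi> l) i (center n \<sigma> \<tau> i v))"
      by (simp add: tuple_of_def vec_eq_iff sl cent slot_others[OF l])
    have exc: "excess g (?P z) = excess g z" for z
    proof -
      have "bij_betw \<rho> (UNIV - {head}) (UNIV - {head})"
        using bij_betw_DiffI[OF bij, of "{head}" "{head}"] \<rho>h by (simp add: bij_betw_def)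
      then have "(\<Sum>r\<in>UNIV - {head}. z $ \<rho> r) = (\<Sum>r\<in>UNIV - {head}. z $ r)"
        by (rule sum.reindex_bij_betw)
      then show ?thesis
        using g(2) bij \<rho>h by (simp add: excess_def tail_symmetric_def)
    qed
    have bel: "belief g (v \<circ> \<pi>) l (?P \<epsilon>) = belief g v (\<pi> l) \<epsilon>" for \<epsilon>
    proof -
      have "?P z + ?P \<epsilon> = ?P (z + \<epsilon>)" for z by (simp add: vec_eq_iff)
      then have "excess g (?P z + ?P \<epsilon>) = excess g (z + \<epsilon>)" for z
        using exc[of "z + \<epsilon>"] by metis
      then show ?thesis by (simp only: belief_def tup pi comp_apply)
    qed
    have noi: "noise l (?P \<epsilon>) = noise (\<pi> l) \<epsilon>" for \<epsilon>
      by (rule centered_gaussian_density_permute[OF bij])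
        (simp add: noise_cov_def sl obs_cov_permute \<pi> l slot_others)
    have [measurable]: "belief g (v \<circ> \<pi>) l \<in> borel_measurable borel"
      by (rule measurable_belief[OF g(1)])
    have "?I (v \<circ> \<pi>) l = (LINT \<epsilon>|distr lborel borel ?P. \<Phi> (belief g (v \<circ> \<pi>) l \<epsilon>) * noise l \<epsilon>)"
      by (simp add: lborel_distr_vec_permute[OF bij])
    also have "\<dots> = (LINT \<epsilon>|lborel. \<Phi> (belief g (v \<circ> \<pi>) l (?P \<epsilon>)) * noise l (?P \<epsilon>))"
      by (subst integral_distr) auto
    also have "\<dots> = ?I v (\<pi> l)" by (simp add: bel noi)
    finally show ?thesis .
  qed
  then show ?thesis
    unfolding participation_def
    using sum.reindex_bij_betw[OF bij\<pi>, of "?I v"] by (simp cong: sum.cong)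
qed

end

section \<open>Contraction and fixed point\<close>

text \<open>Banach's argument for a space of unbounded functions: any two images under
  \<open>T\<close> are within \<open>B\<close>, which replaces finiteness of the sup-distance, and
  closure under pointwise limits replaces completeness.\<close>

lemma bounded_contraction_fixed_point:
  fixes T :: "('a \<Rightarrow> real) \<Rightarrow> 'a \<Rightarrow> real"
  assumes q: "0 \<le> q" "q < 1"
    and maps: "\<And>g. g \<in> L \<Longrightarrow> T g \<in> L"
    and bounded: "\<And>g h y. g \<in> L \<Longrightarrow> h \<in> L \<Longrightarrow> \<bar>T g y - T h y\<bar> \<le> B"
    and contr: "\<And>g h D y. g \<in> L \<Longrightarrow> h \<in> L \<Longrightarrow> (\<And>z. \<bar>g z - h z\<bar> \<le> D) \<Longrightarrow> \<bar>T g y - T h y\<bar> \<le> q * D"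
    and closed: "\<And>f h. (\<And>t. f t \<in> L) \<Longrightarrow> (\<And>y. (\<lambda>t. f t y) \<longlonglongrightarrow> h y) \<Longrightarrow> h \<in> L"
    and g0: "g 0 \<in> L" and g_Suc: "\<And>t. g (Suc t) = T (g t)"
  obtains h where "h \<in> L" "T h = h" "\<And>h'. h' \<in> L \<Longrightarrow> T h' = h' \<Longrightarrow> h' = h"
    "uniform_limit UNIV g h sequentially"
proof -
  have gL: "g t \<in> L" for t by (induction t) (auto simp: g0 g_Suc maps)
  have step: "\<bar>g (Suc (Suc t)) y - g (Suc t) y\<bar> \<le> B * q ^ t" for t y
  proof (induction t arbitrary: y)
    case 0
    then show ?case using bounded[OF gL[of 1] gL[of 0]] by (simp add: g_Suc)
  next
    case (Suc t)
    have "\<bar>T (g (Suc (Suc t))) y - T (g (Suc t)) y\<bar> \<le> q * (B * q ^ t)"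
      by (rule contr[OF gL gL Suc])
    then show ?case by (simp add: g_Suc mult_ac)
  qed
  \<comment> \<open>The telescoping starts at \<open>g 1\<close>, since \<open>g 1 - g 0\<close>
    need not be bounded.\<close>
  define f where "f t y = g (Suc (Suc t)) y - g (Suc t) y" for t y
  have "uniform_limit UNIV (\<lambda>n y. \<Sum>t<n. f t y) (\<lambda>y. \<Sum>t. f t y) sequentially"
  proof (rule Weierstrass_m_test)
    show "norm (f t y) \<le> B * q ^ t" for t y using step by (simp add: f_def)
    show "summable (\<lambda>t. B * q ^ t)"
      using q by (intro summable_mult summable_geometric) simp
  qed
  then have "uniform_limit UNIV (\<lambda>n y. (\<Sum>t<n. f t y) + g 1 y) (\<lambda>y. (\<Sum>t. f t y) + g 1 y) sequentially"
    by (intro uniform_limit_add uniform_limit_const)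
  moreover have "(\<Sum>t<n. f t y) + g 1 y = g (Suc n) y" for n y
    using sum_lessThan_telescope[of "\<lambda>t. g (Suc t) y" n] by (simp add: f_def)
  ultimately have "uniform_limit UNIV (\<lambda>n. g (Suc n)) (\<lambda>y. (\<Sum>t. f t y) + g 1 y) sequentially"
    by simp
  moreover define h where "h = (\<lambda>y. (\<Sum>t. f t y) + g 1 y)"
  ultimately have "uniform_limit UNIV (\<lambda>n. g (Suc n)) h sequentially"
    by simp
  then have lim: "uniform_limit UNIV g h sequentially"
    by (rule filterlim_sequentially_Suc[THEN iffD1])
  have hL: "h \<in> L"
    by (rule closed[OF gL tendsto_uniform_limitI[OF lim UNIV_I]])
  have fixed: "T h y = h y" for y
  proof (rule ccontr)
    \<comment> \<open>Half the gap: an iterate \<open>g (Suc t0) y\<close> would lie within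
      \<open>\<epsilon>\<close> of both \<open>T h y\<close> and \<open>h y\<close>, one of the
      distances being strictly smaller.\<close>
    define \<epsilon> where "\<epsilon> = \<bar>T h y - h y\<bar> / 2"
    assume "T h y \<noteq> h y"
    then have "\<epsilon> > 0" by (simp add: \<epsilon>_def)
    then have "\<forall>\<^sub>F t in sequentially. \<forall>z\<in>UNIV. dist (g t z) (h z) < \<epsilon>"
      using lim by (rule uniform_limitD[rotated])
    then obtain t0 where t0: "\<And>t z. t \<ge> t0 \<Longrightarrow> \<bar>g t z - h z\<bar> < \<epsilon>"
      by (auto simp: eventually_sequentially dist_real_def)
    have "\<bar>T (g t0) y - T h y\<bar> \<le> q * \<epsilon>"
      using t0[of t0] by (intro contr gL hL) (auto intro: less_imp_le)
    also have "\<dots> \<le> 1 * \<epsilon>" using q \<open>\<epsilon> > 0\<close> by (intro mult_right_mono) auto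
    finally have "\<bar>T h y - h y\<bar> < 2 * \<epsilon>"
      using t0[of "Suc t0" y] by (simp add: g_Suc)
    then show False by (simp add: \<epsilon>_def)
  qed
  have unique: "h' = h" if h': "h' \<in> L" "T h' = h'" for h'
  proof
    fix y
    have Th: "T h = h" by (rule ext) (rule fixed)
    \<comment> \<open>Fixed points are images under \<open>T\<close>, so they start within
      \<open>B\<close> of each other; each application of \<open>T\<close> then gains a factor
      \<open>q\<close>.\<close>
    have "\<bar>h' y - h y\<bar> \<le> B * q ^ t" for t
    proof (induction t arbitrary: y)
      case 0
      then show ?case using bounded[OF h'(1) hL, of y] by (simp add: Th h'(2))
    next
      case (Suc t)
      have "\<bar>T h' y - T h y\<bar> \<le> q * (B * q ^ t)" by (rule contr[OF h'(1) hL Suc])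
      then show ?case by (simp add: Th h'(2) mult_ac)
    qed
    moreover have "(\<lambda>t. B * q ^ t) \<longlonglongrightarrow> B * 0"
      using q by (intro tendsto_mult tendsto_const LIMSEQ_power_zero) simp
    ultimately have "\<bar>h' y - h y\<bar> \<le> B * 0"
      by (intro LIMSEQ_le_const) auto
    then show "h' y = h y" by simp
  qed
  show ?thesis
    by (rule that[OF hL ext[OF fixed] unique lim])
qed

section \<open>Contraction constants and the completed observation\<close>

context equilibrium
begin

text \<open>The hypothesis in the shapes that \<open>participation_diff\<close> produces. The first
  entry of the maximum in \<open>coef_w\<close> is the contraction condition and also yields the
  bound for the entry \<open>k\<close>; the second is the condition that \<open>T_op\<close> keeps
  the Lipschitz constant \<open>a\<close>.\<close>

lemma w_bounds:
  assumes "coef_w \<sigma> \<tau> n < \<tau>"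
  shows contraction_bound: "(real n - 1) * ((1 + s * (e * (1 / b))) / (b * \<tau>)) < 1"
    and k_entry_bound: "(real n - 1) * ((s * e) / (b * \<tau>)) < b"
    and lipschitz_bound: "(real n - 1) * ((s * (e * (1 + 2 * a / b)) + b) / (b * \<tau>)) \<le> a"
proof -
  have w: "(real n - 1) * (e * s + b) / b\<^sup>2 < \<tau>"
    "(real n - 1) * (e * s * (b + 2 * a) + b\<^sup>2) / (a * b\<^sup>2) < \<tau>"
    using assms by (simp_all add: coef_w_def Let_def)
  have w1: "(real n - 1) * (e * s + b) / b\<^sup>2 / \<tau> < 1"
    by (subst pos_divide_less_eq[OF \<tau>_pos]) (use w(1) in simp)
  have w2: "(real n - 1) * (e * s * (b + 2 * a) + b\<^sup>2) / (a * b\<^sup>2) / \<tau> \<le> 1"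
    by (subst pos_divide_le_eq[OF \<tau>_pos]) (use w(2) in simp)
  show "(real n - 1) * ((1 + s * (e * (1 / b))) / (b * \<tau>)) < 1"
  proof -
    have "(real n - 1) * ((1 + s * (e * (1 / b))) / (b * \<tau>)) = (real n - 1) * (e * s + b) / b\<^sup>2 / \<tau>"
      using b_pos \<tau>_pos by (simp add: field_simps power2_eq_square)
    also have "\<dots> < 1" using w1 .
    finally show ?thesis .
  qed
  show "(real n - 1) * ((s * e) / (b * \<tau>)) < b"
  proof -
    have "(real n - 1) * ((s * e) / (b * \<tau>)) = b * ((real n - 1) * (e * s) / b\<^sup>2 / \<tau>)"
      using b_pos \<tau>_pos by (simp add: field_simps power2_eq_square)
    also have "\<dots> < b * 1"
    proof (rule mult_strict_left_mono[OF _ b_pos])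
      have "(real n - 1) * (e * s) / b\<^sup>2 / \<tau> \<le> (real n - 1) * (e * s + b) / b\<^sup>2 / \<tau>"
        using b_pos \<tau>_pos n_ge_2 by (intro divide_right_mono mult_left_mono) auto
      then show "(real n - 1) * (e * s) / b\<^sup>2 / \<tau> < 1" using w1 by (rule le_less_trans)
    qed
    finally show ?thesis by simp
  qed
  show "(real n - 1) * ((s * (e * (1 + 2 * a / b)) + b) / (b * \<tau>)) \<le> a"
  proof -
    have "(real n - 1) * ((s * (e * (1 + 2 * a / b)) + b) / (b * \<tau>))
        = a * ((real n - 1) * (e * s * (b + 2 * a) + b\<^sup>2) / (a * b\<^sup>2) / \<tau>)"
      using a_pos b_pos \<tau>_pos by (simp add: field_simps power2_eq_square)
    also have "\<dots> \<le> a * 1" by (rule mult_left_mono[OF w2 less_imp_le[OF a_pos]])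
    finally show ?thesis by simp
  qed
qed

text \<open>The posterior mean of \<open>\<theta>\<close> given the observation: \<open>a\<close>
  and \<open>b\<close> are the precision weights of variances \<open>\<sigma>\<^sup>2\<close> and
  \<open>\<sigma>\<^sup>2 + \<tau>\<^sup>2\<close>. The completion chooses its missing entry so that
  this mean equals \<open>g y\<close>.\<close>

definition linear_part :: "(nat \<Rightarrow> real) \<Rightarrow> real" where
  "linear_part v = a * v i + b * (\<Sum>j\<in>others. v j)"

abbreviation "T \<equiv> T_op n \<sigma> \<tau> i k :: ((real, 'm) vec \<Rightarrow> real) \<Rightarrow> (real, 'm) vec \<Rightarrow> real"
abbreviation "completed \<equiv> completion n \<sigma> \<tau> i k :: ((real, 'm) vec \<Rightarrow> real) \<Rightarrow> (real, 'm) vec \<Rightarrow> nat \<Rightarrow> real"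

lemma complete_other: "m \<noteq> k \<Longrightarrow> completed g y m = family_of n i k y m"
  by (simp add: completion_def Let_def)

lemma linear_part_complete: "linear_part (completed g y) = g y"
proof -
  have "(\<Sum>j\<in>others. completed g y j) = completed g y k + (\<Sum>j\<in>others - {k}. completed g y j)"
    using k_others by (simp add: sum.remove)
  also have "(\<Sum>j\<in>others - {k}. completed g y j) = (\<Sum>j\<in>{1..n} - {k, i}. family_of n i k y j)"
    by (rule sum.cong) (auto simp: others_def complete_other)
  also have "completed g y k = g y / b - a / b * family_of n i k y i - (\<Sum>j\<in>{1..n} - {k, i}. family_of n i k y j)"
    by (simp add: completion_def Let_def)
  finally show ?thesis
    using k_agent b_pos by (simp add: linear_part_def complete_other field_simps)
qed

lemma tuple_of_complete: "tuple_of n i k (completed g y) = y"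
proof -
  have "tuple_of n i k (completed g y) = (tuple_of n i k (family_of n i k y) :: (real, 'm) vec)"
  proof -
    have "slot n i k r \<noteq> k" for r :: 'm using bij_slot_k by (auto dest: bij_betwE)
    then show ?thesis by (simp add: tuple_of_def vec_eq_iff complete_other)
  qed
  then show ?thesis
    using tuple_of_family_of[OF card_positions i_agent k_agent(1)] k_agent by simp
qed

lemma complete_tuple_of:
  assumes "m \<in> {1..n}" "m \<noteq> k"
  shows "completed g (tuple_of n i k v) m = v m"
  using assms family_of_tuple_of[OF card_positions i_agent k_agent(1)] k_agent by (simp add: complete_other)

text \<open>As \<open>b\<close> is positive, \<open>linear_part\<close> determines the entry
  \<open>k\<close> from the others.\<close>

lemma complete_tuple_of_eq:
  assumes "g (tuple_of n i k v) = linear_part v" "m \<in> {1..n}"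
  shows "completed g (tuple_of n i k v) m = v m"
proof (cases "m = k")
  case True
  let ?v = "completed g (tuple_of n i k v)"
  have "(\<Sum>j\<in>others - {k}. ?v j) = (\<Sum>j\<in>others - {k}. v j)"
    by (rule sum.cong) (auto simp: others_def complete_tuple_of)
  moreover have "linear_part ?v = linear_part v" by (simp add: linear_part_complete assms)
  moreover have "?v i = v i" using i_agent k_agent by (intro complete_tuple_of) auto
  ultimately show ?thesis
    using True k_others b_pos by (simp add: linear_part_def sum.remove[of others k])
qed (use assms in \<open>simp add: complete_tuple_of\<close>)

lemma l1_family_of:
  "(\<Sum>m\<in>{1..n} - {k}. \<bar>family_of n i k y m - family_of n i k (z :: (real, 'm) vec) m\<bar>) = (\<Sum>r\<in>UNIV. \<bar>y $ r - z $ r\<bar>)"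
  using bij_slot_k
  by (subst sum.reindex_bij_betw[OF bij_slot_k, symmetric]) (simp add: family_of_def bij_betw_def)

text \<open>The given entries contribute \<open>L y z\<close>. The solved entry contributes
  \<open>a / b\<close> times this distance through \<open>g\<close> and as much again through the
  explicit terms, where \<open>b \<le> a\<close> lets \<open>a / b\<close> dominate the coefficient
  one of the other links.\<close>

lemma complete_diff:
  assumes "lip g"
  defines "L \<equiv> (\<lambda>y z :: (real, 'm) vec. \<Sum>r\<in>UNIV. \<bar>y $ r - z $ r\<bar>)"
  shows "(\<Sum>m\<in>{1..n}. \<bar>completed g y m - completed g z m\<bar>) \<le> (1 + 2 * a / b) * L y z"
    and "\<bar>completed g y i - completed g z i\<bar> \<le> L y z"
proof -
  let ?u = "family_of n i k y" and ?u' = "family_of n i k z"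
  let ?A = "{1..n} - {k, i}"
  have sub: "{1..n} - {k} = insert i ?A" using i_agent k_agent by auto
  have Leq: "L y z = \<bar>?u i - ?u' i\<bar> + (\<Sum>m\<in>?A. \<bar>?u m - ?u' m\<bar>)"
    unfolding L_def l1_family_of[symmetric] sub by simp
  then show "\<bar>completed g y i - completed g z i\<bar> \<le> L y z"
    using k_agent by (simp add: complete_other sum_nonneg)
  have "\<bar>g y - g z\<bar> \<le> a * L y z"
    using assms by (simp add: lip_def)
  then have 1: "\<bar>(g y - g z) / b\<bar> \<le> a * L y z / b"
    using b_pos by (simp add: divide_right_mono)
  have ab: "a / b \<ge> 1" using b_le_a b_pos by simp
  have "\<bar>a / b * (?u i - ?u' i)\<bar> + \<bar>\<Sum>m\<in>?A. ?u m - ?u' m\<bar>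
      \<le> a / b * \<bar>?u i - ?u' i\<bar> + a / b * (\<Sum>m\<in>?A. \<bar>?u m - ?u' m\<bar>)"
  proof (intro add_mono)
    show "\<bar>a / b * (?u i - ?u' i)\<bar> \<le> a / b * \<bar>?u i - ?u' i\<bar>"
      using a_pos b_pos by (simp add: abs_mult)
    have "\<bar>\<Sum>m\<in>?A. ?u m - ?u' m\<bar> \<le> 1 * (\<Sum>m\<in>?A. \<bar>?u m - ?u' m\<bar>)"
      by (simp add: sum_abs)
    also have "\<dots> \<le> a / b * (\<Sum>m\<in>?A. \<bar>?u m - ?u' m\<bar>)"
      using ab by (intro mult_right_mono sum_nonneg) auto
    finally show "\<bar>\<Sum>m\<in>?A. ?u m - ?u' m\<bar> \<le> a / b * (\<Sum>m\<in>?A. \<bar>?u m - ?u' m\<bar>)" .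
  qed
  then have 2: "\<bar>a / b * (?u i - ?u' i)\<bar> + \<bar>\<Sum>m\<in>?A. ?u m - ?u' m\<bar> \<le> a * L y z / b"
    unfolding Leq by (simp add: distrib_left add_divide_distrib)
  have "completed g y k - completed g z k = (g y - g z) / b - a / b * (?u i - ?u' i) - (\<Sum>m\<in>?A. ?u m - ?u' m)"
    by (simp add: completion_def Let_def sum_subtractf algebra_simps diff_divide_distrib)
  then have "\<bar>completed g y k - completed g z k\<bar> \<le> 2 * (a * L y z / b)"
    using 1 2 by linarith
  moreover have "(\<Sum>m\<in>{1..n} - {k}. \<bar>completed g y m - completed g z m\<bar>) = L y z"
    unfolding L_def l1_family_of[symmetric] by (rule sum.cong) (auto simp: complete_other)
  ultimately show "(\<Sum>m\<in>{1..n}. \<bar>completed g y m - completed g z m\<bar>) \<le> (1 + 2 * a / b) * L y z"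
    using k_agent by (subst sum.remove[of _ k]) (auto simp: algebra_simps)
qed

lemma lip_T:
  assumes w: "coef_w \<sigma> \<tau> n < \<tau>" and g: "lip g"
  shows "lip (T g)"
  unfolding lip_def
proof (intro allI)
  fix y z :: "(real, 'm) vec"
  define L where "L = (\<Sum>r\<in>UNIV. \<bar>y $ r - z $ r\<bar>)"
  have L: "L \<ge> 0" by (simp add: L_def sum_nonneg)
  have "\<bar>T g y - T g z\<bar> \<le> (real n - 1) * ((0 + s * (e * ((1 + 2 * a / b) * L)) + b * L) / (b * \<tau>))"
    unfolding T_op_eq_participation L_def by (rule participation_diff[OF g g _ complete_diff[OF g]]) simp
  also have "\<dots> = (real n - 1) * ((s * (e * (1 + 2 * a / b)) + b) / (b * \<tau>)) * L"
    by (simp add: algebra_simps add_divide_distrib)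
  also have "\<dots> \<le> a * L"
    using lipschitz_bound[OF w] L by (rule mult_right_mono)
  finally show "\<bar>T g y - T g z\<bar> \<le> a * (\<Sum>r\<in>UNIV. \<bar>y $ r - z $ r\<bar>)" by (simp add: L_def)
qed

text \<open>For the same \<open>y\<close>, the completions by \<open>g\<close> and \<open>h\<close>
  differ only in the entry \<open>k\<close>, by \<open>(g y - h y) / b\<close>; the own signal is
  unchanged.\<close>

lemma T_contraction:
  assumes g: "lip g" "lip h" and D: "\<And>z. \<bar>g z - h z\<bar> \<le> D"
  shows "\<bar>T g y - T h y\<bar> \<le> (real n - 1) * ((1 + s * (e * (1 / b))) / (b * \<tau>)) * D"
proof -
  have "completed g y k - completed h y k = (g y - h y) / b"
    by (simp add: completion_def Let_def diff_divide_distrib)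
  then have ck: "\<bar>completed g y k - completed h y k\<bar> \<le> D / b"
    using D[of y] b_pos by (simp add: divide_right_mono)
  have "(\<Sum>m\<in>{1..n} - {k}. \<bar>completed g y m - completed h y m\<bar>) = 0"
    by (rule sum.neutral) (auto simp: complete_other)
  then have V: "(\<Sum>m\<in>{1..n}. \<bar>completed g y m - completed h y m\<bar>) \<le> D / b"
    using k_agent ck by (subst sum.remove[of _ k]) auto
  have "\<bar>T g y - T h y\<bar> \<le> (real n - 1) * ((D + s * (e * (D / b)) + b * 0) / (b * \<tau>))"
    unfolding T_op_eq_participation
    by (rule participation_diff[OF g D V]) (use k_agent in \<open>simp add: complete_other\<close>)
  also have "\<dots> = (real n - 1) * ((1 + s * (e * (1 / b))) / (b * \<tau>)) * D"
    by (simp add: algebra_simps add_divide_distrib)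
  finally show ?thesis .
qed

section \<open>Symmetry of the iterates and of the zero set\<close>

lemma slot_k_conjugate:
  assumes \<rho>: "bij \<rho>" "\<rho> (head :: 'm) = head"
  obtains \<pi> where "\<pi> permutes (others - {k})" "\<And>r :: 'm. slot n i k (\<rho> r) = \<pi> (slot n i k r)"
proof -
  let ?sl = "slot n i k :: 'm \<Rightarrow> nat"
  \<comment> \<open>The conjugate of \<open>\<rho>\<close> by the slot bijection, extended by the
    identity as \<open>permutes\<close> demands. It fixes \<open>i\<close> because
    \<open>\<rho>\<close> fixes \<open>head\<close>.\<close>
  define \<pi> where "\<pi> j = (if j \<in> {1..n} - {k} then ?sl (\<rho> (inv ?sl j)) else j)" for j
  have inv: "bij_betw (inv ?sl) ({1..n} - {k}) UNIV" by (rule bij_betw_inv_into[OF bij_slot_k])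
  have "bij_betw (?sl \<circ> (\<rho> \<circ> inv ?sl)) ({1..n} - {k}) ({1..n} - {k})"
    by (rule bij_betw_trans[OF bij_betw_trans[OF inv \<rho>(1)] bij_slot_k])
  then have bij: "bij_betw \<pi> ({1..n} - {k}) ({1..n} - {k})"
    by (rule bij_betw_cong[THEN iffD1, rotated]) (simp add: \<pi>_def)
  have sl: "?sl (\<rho> r) = \<pi> (?sl r)" for r
  proof -
    have "?sl r \<in> {1..n} - {k}" using bij_slot_k by (rule bij_betwE[THEN bspec]) simp
    moreover have "inv ?sl (?sl r) = r" using bij_slot_k by (simp add: bij_betw_def)
    ultimately show ?thesis by (simp only: \<pi>_def if_True)
  qed
  have "\<pi> i = i"
    using sl[of head] by (simp add: \<rho>(2) slot_head)
  then have "bij_betw \<pi> ({1..n} - {k} - {i}) ({1..n} - {k} - {i})"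
    using bij_betw_DiffI[OF bij, of "{i}" "{i}"] i_agent k_agent by (simp add: bij_betw_def)
  moreover have "{1..n} - {k} - {i} = others - {k}" by (auto simp: others_def)
  ultimately have "bij_betw \<pi> (others - {k}) (others - {k})" by simp
  then have "\<pi> permutes (others - {k})"
    by (rule bij_imp_permutes) (use \<open>\<pi> i = i\<close> in \<open>auto simp: others_def \<pi>_def\<close>)
  then show ?thesis using sl that by blast
qed

lemma permutes_others_k: "\<pi> permutes (others - {k}) \<Longrightarrow> \<pi> permutes others"
  by (rule permutes_subset) auto

text \<open>Permuting the tail of \<open>y\<close> permutes its completion: the permuted completion
  restricts to the permuted tuple, because \<open>\<pi>\<close> fixes \<open>k\<close>, and has the
  same linear part, so it solves the equation for the missing entry.\<close>

lemma tail_symmetric_T: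
  assumes g: "lip g" "tail_symmetric g"
  shows "tail_symmetric (T g)"
  unfolding tail_symmetric_def
proof (intro allI impI)
  fix \<rho> :: "'m \<Rightarrow> 'm" and y :: "(real, 'm) vec" assume \<rho>: "bij \<rho>" "\<rho> head = head"
  obtain \<pi> where \<pi>: "\<pi> permutes (others - {k})" and sl: "\<And>r :: 'm. slot n i k (\<rho> r) = \<pi> (slot n i k r)"
    using slot_k_conjugate[OF \<rho>] by blast
  let ?y = "\<chi> r. y $ \<rho> r"
  have \<pi>': "\<pi> permutes others" using \<pi> by (rule permutes_others_k)
  have \<pi>i: "\<pi> i = i" using \<pi>' by (simp add: others_def permutes_not_in)
  have \<pi>k: "\<pi> k = k" using \<pi> by (simp add: permutes_not_in)
  have tup: "tuple_of n i k (completed g y \<circ> \<pi>) = ?y"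
  proof -
    have "(completed g y \<circ> \<pi>) (slot n i k r) = y $ \<rho> r" for r :: 'm
      using arg_cong[OF tuple_of_complete[of g y], of "\<lambda>z. z $ \<rho> r"] by (simp add: tuple_of_def sl)
    then show ?thesis by (simp add: tuple_of_def vec_eq_iff)
  qed
  have "g ?y = g y" using g(2) \<rho> by (simp add: tail_symmetric_def)
  also have "\<dots> = linear_part (completed g y \<circ> \<pi>)"
    using sum.reindex_bij_betw[OF permutes_imp_bij[OF \<pi>'], of "completed g y"]
    by (simp add: linear_part_complete[of g y, symmetric] linear_part_def \<pi>i)
  finally have "completed g ?y m = (completed g y \<circ> \<pi>) m" if "m \<in> {1..n}" for m
    using complete_tuple_of_eq[of g "completed g y \<circ> \<pi>"] that by (simp add: tup)
  then have "T g ?y = participation g (completed g y \<circ> \<pi>)"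
    unfolding T_op_eq_participation by (rule participation_cong[OF g(1)])
  also have "\<dots> = T g y"
    unfolding T_op_eq_participation by (rule participation_permute[OF g \<pi>'])
  finally show "T g ?y = T g y" .
qed

lemma h_fun_eq: "h_fun n \<sigma> \<tau> i k g v = (g (tuple_of n i k v :: (real, 'm) vec) - linear_part v) / b"
  using b_pos by (simp add: h_fun_def linear_part_def others_def field_simps)

text \<open>The completion lifts \<open>y\<close> to a zero of \<open>h_fun g\<close>. A permutation
  fixing \<open>i\<close> and \<open>k\<close> moves it to another zero with the same linear part,
  whose tuple is the permuted \<open>y\<close>; hence \<open>g\<close> takes the same value
  there.\<close>

lemma F_space_lip_symmetric:
  assumes "g \<in> F_space n \<sigma> \<tau> i k"
  shows "lip g" "tail_symmetric g"
proof -
  show "lip g" using assms by (simp add: F_space_def lip_def)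
  define Z where "Z = {v \<in> {1..n} \<rightarrow>\<^sub>E UNIV. h_fun n \<sigma> \<tau> i k g v = 0}"
  have Z: "(\<lambda>v. v \<circ> \<pi>) ` Z = Z" if "\<pi> permutes others" for \<pi>
    using assms that by (simp add: F_space_def quasi_symmetric_def Let_def Z_def others_def)
  show "tail_symmetric g"
    unfolding tail_symmetric_def
  proof (intro allI impI)
    fix \<rho> :: "'m \<Rightarrow> 'm" and y :: "(real, 'm) vec" assume \<rho>: "bij \<rho>" "\<rho> head = head"
    obtain \<pi> where \<pi>: "\<pi> permutes (others - {k})" and sl: "\<And>r :: 'm. slot n i k (\<rho> r) = \<pi> (slot n i k r)"
      using slot_k_conjugate[OF \<rho>] by blast
    have \<pi>': "\<pi> permutes others" using \<pi> by (rule permutes_others_k)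
    have \<pi>i: "\<pi> i = i" using \<pi>' by (simp add: others_def permutes_not_in)
    \<comment> \<open>The zero set in \<open>quasi_symmetric\<close> consists of extensional
      families, so the completion is cut down to the agents.\<close>
    define v where "v = restrict (completed g y) {1..n}"
    have slot_in: "slot n i k (r :: 'm) \<in> {1..n}" for r
      using bij_slot_k by (auto dest: bij_betwE)
    have tv: "tuple_of n i k v = y"
      using tuple_of_complete[of g y] slot_in by (simp add: tuple_of_def v_def vec_eq_iff)
    have lv: "linear_part v = g y"
    proof -
      have "(\<Sum>j\<in>others. v j) = (\<Sum>j\<in>others. completed g y j)"
        by (rule sum.cong) (auto simp: v_def others_def)
      then show ?thesis
        using i_agent linear_part_complete[of g y] by (simp add: linear_part_def v_def)
    qed
    have "v \<in> Z" using b_pos by (simp add: Z_def h_fun_eq tv lv) (simp add: v_def)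
    then have "v \<circ> \<pi> \<in> Z" using Z[OF \<pi>'] by blast
    then have "g (tuple_of n i k (v \<circ> \<pi>)) = linear_part (v \<circ> \<pi>)"
      using b_pos by (simp add: Z_def h_fun_eq)
    moreover have "tuple_of n i k (v \<circ> \<pi>) = (\<chi> r. y $ \<rho> r)"
    proof -
      have "(v \<circ> \<pi>) (slot n i k r) = y $ \<rho> r" for r :: 'm
        using arg_cong[OF tv, of "\<lambda>z. z $ \<rho> r"] by (simp add: tuple_of_def sl)
      then show ?thesis by (simp add: tuple_of_def vec_eq_iff)
    qed
    moreover have "linear_part (v \<circ> \<pi>) = linear_part v"
      using sum.reindex_bij_betw[OF permutes_imp_bij[OF \<pi>'], of v] by (simp add: linear_part_def \<pi>i)
    ultimately show "g (\<chi> r. y $ \<rho> r) = g y" by (simp add: lv)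
  qed
qed

lemma fixed_point_in_F_space:
  assumes w: "coef_w \<sigma> \<tau> n < \<tau>" and h: "lip h" "tail_symmetric h" and fixed: "T h = h"
  shows "h \<in> F_space n \<sigma> \<tau> i k"
proof -
  have zero_iff: "h_fun n \<sigma> \<tau> i k h v = 0 \<longleftrightarrow> participation h v = linear_part v" for v
  proof -
    let ?v = "completed h (tuple_of n i k v)"
    have fx: "participation h ?v = h (tuple_of n i k v)"
      using fun_cong[OF fixed, of "tuple_of n i k v"] by (simp add: T_op_eq_participation)
    show ?thesis
    proof
      assume "h_fun n \<sigma> \<tau> i k h v = 0"
      then have *: "h (tuple_of n i k v) = linear_part v" using b_pos by (simp add: h_fun_eq)
      have "participation h v = participation h ?v"
        by (rule participation_cong[OF h(1)]) (simp add: complete_tuple_of_eq[of h v, OF *])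
      then show "participation h v = linear_part v" using fx * by simp
    next
      assume *: "participation h v = linear_part v"
      \<comment> \<open>\<open>v\<close> and its completion both satisfy
        \<open>participation h = linear_part\<close> and differ at most in the entry
        \<open>k\<close>. The linear part varies there by \<open>b * \<delta>\<close>, participation
        by strictly less unless \<open>\<delta> = 0\<close>.\<close>
      define \<delta> where "\<delta> = \<bar>v k - ?v k\<bar>"
      have vi: "?v i = v i" using i_agent k_agent by (intro complete_tuple_of) auto
      have "(\<Sum>m\<in>{1..n} - {k}. \<bar>v m - ?v m\<bar>) = 0"
        by (rule sum.neutral) (auto simp: complete_tuple_of)
      then have V: "(\<Sum>m\<in>{1..n}. \<bar>v m - ?v m\<bar>) \<le> \<delta>"
        using k_agent by (subst sum.remove[of _ k]) (auto simp: \<delta>_def)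
      have "linear_part v - linear_part ?v = b * (v k - ?v k)"
      proof -
        have "(\<Sum>j\<in>others - {k}. ?v j) = (\<Sum>j\<in>others - {k}. v j)"
          by (rule sum.cong) (auto simp: others_def complete_tuple_of)
        then show ?thesis
          using k_others by (simp add: linear_part_def vi sum.remove[of others k] algebra_simps)
      qed
      then have "b * \<delta> = \<bar>participation h v - participation h ?v\<bar>"
        using b_pos fx by (simp add: * linear_part_complete \<delta>_def abs_mult)
      also have "\<dots> \<le> (real n - 1) * ((0 + s * (e * \<delta>) + b * 0) / (b * \<tau>))"
        by (rule participation_diff[OF h(1) h(1) _ V]) (simp_all add: vi)
      also have "\<dots> = (real n - 1) * ((s * e) / (b * \<tau>)) * \<delta>"
        by (simp add: algebra_simps)
      finally have "\<delta> \<le> 0"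
        using k_entry_bound[OF w] mult_strict_right_mono[of "(real n - 1) * ((s * e) / (b * \<tau>))" b \<delta>]
        by force
      then have "v k = ?v k" by (simp add: \<delta>_def)
      then have "participation h v = participation h ?v"
        by (intro participation_cong[OF h(1)]) (metis complete_tuple_of)
      then show "h_fun n \<sigma> \<tau> i k h v = 0"
        using * fx by (simp add: h_fun_eq)
    qed
  qed
  define Z where "Z = {v \<in> {1..n} \<rightarrow>\<^sub>E UNIV. h_fun n \<sigma> \<tau> i k h v = 0}"
  have sub: "v \<circ> \<pi> \<in> Z" if \<pi>: "\<pi> permutes others" and v: "v \<in> Z" for v \<pi>
  proof -
    have \<pi>i: "\<pi> i = i" using \<pi> by (simp add: others_def permutes_not_in)
    have "\<pi> m = m" if "m \<notin> {1..n}" for m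
      using permutes_not_in[OF \<pi>, of m] that by (auto simp: others_def)
    then have "v \<circ> \<pi> \<in> {1..n} \<rightarrow>\<^sub>E UNIV"
      using v by (auto simp: Z_def PiE_iff extensional_def)
    moreover have "linear_part (v \<circ> \<pi>) = linear_part v"
      using sum.reindex_bij_betw[OF permutes_imp_bij[OF \<pi>], of v] by (simp add: linear_part_def \<pi>i)
    ultimately show ?thesis
      using v participation_permute[OF h \<pi>] by (simp add: Z_def zero_iff)
  qed
  \<comment> \<open>The inclusion for the inverse permutation upgrades \<open>sub\<close> to
    equality.\<close>
  have "(\<lambda>v. v \<circ> \<pi>) ` Z = Z" if \<pi>: "\<pi> permutes others" for \<pi>
  proof (intro equalityI subsetI)
    fix v assume "v \<in> (\<lambda>v. v \<circ> \<pi>) ` Z"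
    then show "v \<in> Z" using sub[OF \<pi>] by auto
  next
    fix v assume "v \<in> Z"
    then have "v \<circ> inv \<pi> \<in> Z" using sub[OF permutes_inv[OF \<pi>]] by blast
    moreover have "v = (v \<circ> inv \<pi>) \<circ> \<pi>"
      using permutes_inv_o(2)[OF \<pi>] by (simp add: comp_assoc)
    ultimately show "v \<in> (\<lambda>v. v \<circ> \<pi>) ` Z" by blast
  qed
  then have "quasi_symmetric n \<sigma> \<tau> i k h"
    unfolding quasi_symmetric_def Let_def others_def Z_def by blast
  then show ?thesis using h(1) by (simp add: F_space_def lip_def)
qed

lemma lip_symmetric_closed:
  assumes f: "\<And>t. lip (f t) \<and> tail_symmetric (f t)" and lim: "\<And>y. (\<lambda>t. f t y) \<longlonglongrightarrow> h y"
  shows "lip h \<and> tail_symmetric h"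
proof
  show "lip h"
    unfolding lip_def
  proof (intro allI)
    fix y z :: "(real, 'm) vec"
    have "(\<lambda>t. \<bar>f t y - f t z\<bar>) \<longlonglongrightarrow> \<bar>h y - h z\<bar>" by (intro tendsto_intros lim)
    then show "\<bar>h y - h z\<bar> \<le> a * (\<Sum>r\<in>UNIV. \<bar>y $ r - z $ r\<bar>)"
      by (rule LIMSEQ_le_const2) (use f in \<open>auto simp: lip_def\<close>)
  qed
  show "tail_symmetric h"
    unfolding tail_symmetric_def
  proof (intro allI impI)
    fix \<rho> :: "'m \<Rightarrow> 'm" and z assume "bij \<rho>" "\<rho> head = head"
    then have "f t (\<chi> r. z $ \<rho> r) = f t z" for t using f by (simp add: tail_symmetric_def)
    then show "h (\<chi> r. z $ \<rho> r) = h z"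
      using lim[of "\<chi> r. z $ \<rho> r"] lim[of z] LIMSEQ_unique by simp
  qed
qed

section \<open>Existence, uniqueness and uniform convergence\<close>

theorem fixed_point_iteration:
  fixes g :: "nat \<Rightarrow> (real, 'm) vec \<Rightarrow> real"
  assumes w: "coef_w \<sigma> \<tau> n < \<tau>" and g0: "g 0 \<in> F_space n \<sigma> \<tau> i k"
    and g_Suc: "\<And>t. g (Suc t) = T_op n \<sigma> \<tau> i k (g t)"
  shows "\<exists>h. h \<in> F_space n \<sigma> \<tau> i k \<and> T_op n \<sigma> \<tau> i k h = h
           \<and> (\<forall>h'\<in>F_space n \<sigma> \<tau> i k. T_op n \<sigma> \<tau> i k h' = h' \<longrightarrow> h' = h)
           \<and> uniform_limit UNIV g h sequentially"
proof -
  define L where "L = {g :: (real, 'm) vec \<Rightarrow> real. lip g \<and> tail_symmetric g}"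
  define q where "q = (real n - 1) * ((1 + s * (e * (1 / b))) / (b * \<tau>))"
  have q: "0 \<le> q" "q < 1"
    using contraction_bound[OF w] n_ge_2 s_nonneg e_nonneg b_pos \<tau>_pos
    by (auto simp: q_def intro!: mult_nonneg_nonneg divide_nonneg_nonneg add_nonneg_nonneg)
  have "\<bar>T g y - T h y\<bar> \<le> real n" if "g \<in> L" "h \<in> L" for g h y
    using that participation_bounds[of g "completed g y"] participation_bounds[of h "completed h y"]
    by (simp add: L_def T_op_eq_participation abs_le_iff)
  moreover have "T g \<in> L" if "g \<in> L" for g
    using that lip_T[OF w] tail_symmetric_T by (simp add: L_def)
  moreover have "\<bar>T g y - T h y\<bar> \<le> q * D" if "g \<in> L" "h \<in> L" "\<And>z. \<bar>g z - h z\<bar> \<le> D" for g h D y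
    unfolding q_def using that by (intro T_contraction) (auto simp: L_def)
  moreover have "h \<in> L" if "\<And>t. f t \<in> L" "\<And>y. (\<lambda>t. f t y) \<longlonglongrightarrow> h y" for f :: "nat \<Rightarrow> _" and h
    using that lip_symmetric_closed[of f h] by (simp add: L_def)
  moreover have "g 0 \<in> L"
    using F_space_lip_symmetric[OF g0] by (simp add: L_def)
  ultimately obtain h where h: "h \<in> L" "T h = h" "\<And>h'. h' \<in> L \<Longrightarrow> T h' = h' \<Longrightarrow> h' = h"
    "uniform_limit UNIV g h sequentially"
    using bounded_contraction_fixed_point[OF q, of L T "real n" g] g_Suc by blast
  have "h \<in> F_space n \<sigma> \<tau> i k"
    using fixed_point_in_F_space[OF w] h(1,2) by (simp add: L_def)
  \<comment> \<open>Uniqueness is inherited from the larger space \<open>L\<close>, which contains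
    \<open>F_space\<close>.\<close>
  moreover have "h' = h" if "h' \<in> F_space n \<sigma> \<tau> i k" "T h' = h'" for h'
    using F_space_lip_symmetric[OF that(1)] that(2) h(3) by (simp add: L_def)
  ultimately show ?thesis using h(2,4) by blast
qed

end

theorem theorem9:
  fixes n i k :: nat and \<sigma> \<tau> :: real
    and g :: "nat \<Rightarrow> (real ^ 'm::{finite,linorder} \<Rightarrow> real)"
  assumes "n \<ge> 2" and "CARD('m) + 1 = n"
    and "i \<in> {1..n}" and "k \<in> {1..n}" and "i \<noteq> k"
    and "\<sigma> > 0" and "\<tau> > 0"
    and "coef_w \<sigma> \<tau> n < \<tau>"
    and "g 0 \<in> F_space n \<sigma> \<tau> i k"
    and "\<And>t. g (Suc t) = T_op n \<sigma> \<tau> i k (g t)"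
  shows "\<exists>h. h \<in> F_space n \<sigma> \<tau> i k \<and> T_op n \<sigma> \<tau> i k h = h
           \<and> (\<forall>h'\<in>F_space n \<sigma> \<tau> i k. T_op n \<sigma> \<tau> i k h' = h' \<longrightarrow> h' = h)
           \<and> uniform_limit UNIV g h sequentially"
proof -
  interpret equilibrium n i \<sigma> \<tau> k "TYPE('m)"
    using assms by unfold_locales auto
  show ?thesis using assms(8-10) by (rule fixed_point_iteration)
qed

end
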